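(* Let $\mathcal X\subset\mathbb R$ be a compact interval of length $L>0$, $x_{1,n},\ldots,x_{n,n}$ equispaced points in $\mathcal X$ such that $x_{i+1,n}-x_{i,n}=L/n$ for $i\in\{1,\ldots,n-1\}$, $k\ge1$ an integer, and $f$ an element of $\mathcal C_k$, associated with a partition $\mathcal J$ of $\mathcal X$, with variation $V=V(f)$ and $\mathcal J$-variation-index $W=W_{\mathcal J}(f)$. Then, for every $\gamma>0$, there exists an element $\overline f=\overline f(\gamma)$ in $\mathcal O_{\mathrm{pl}}(\lfloor2(k+\gamma)\rfloor)$ such that $$\frac1n\sum_{i=1}^n\left|f(x_{i,n})-\overline f(x_{i,n})\right|\le\frac{W}{\gamma^2}+\frac{2V}{n}.$$
   Context: A nontrivial interval is an interval with positive length. A function is convex-concave on an interval if it is either convex or concave on it. $\mathcal C_k$ is the class of functions $f$ that are continuous on $\mathcal X$ and for which there is a partition $\mathcal J$ of $\mathcal X$ into at most $k$ nontrivial intervals on the closure of each of which $f$ is monotone and convex-concave ($\mathcal J$ is said to be associated with $f$). A function is $K$-piecewise linear on $\mathcal X$ if it is continuous on $\mathcal X$ and affine on each element of a partition of $\mathcal X$ into at most $K$ nontrivial intervals. $\mathcal O_{\mathrm{pl}}(K)$ is the set of $K$-piecewise linear functions which belong to $\mathcal C_k$. Linear index: for a continuous, monotone, convex-concave function $f$ on $[a,b]$, $a<b$, with right and left derivatives $f'_r,f'_l$ (allowed to be $\pm\infty$), $$\Gamma(f)=1-\frac12\left[\frac{|f'_r(a)|\wedge|f'_l(b)|}{|\Delta|}+\frac{|\Delta|}{|f'_r(a)|\vee|f'_l(b)|}\right],\quad\Delta=\frac{f(b)-f(a)}{b-a},$$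 with $0/0=1$ and $1/(+\infty)=0$. For $f\in\mathcal C_k$ with partition $\mathcal J$ and $J\in\mathcal J$: $n_J$ is the number of points $x_{i,n}$ that fall in $J$, $V_J(f)=\sup_Jf-\inf_Jf$, $\Gamma_J(f)$ is the linear index of $f$ on the closure of $J$, $V(f)=\sum_{J\in\mathcal J}V_J(f)$, and $$W_{\mathcal J}(f)=\left[\sum_{J\in\mathcal J}\left(\frac{n_JV_J(f)\Gamma_J(f)}{n}\right)^{1/3}\right]^3.$$ $\lfloor x\rfloor$ is the largest integer not larger than $x$. *)

theory Defs
  imports "HOL-Analysis.Analysis" "HOL-Library.Disjoint_Sets"
begin

definition nontrivial_interval :: "real set \<Rightarrow> bool" where
  "nontrivial_interval J \<longleftrightarrow> is_interval J \<and> 0 < emeasure lborel J"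

definition interval_partition :: "nat \<Rightarrow> real set \<Rightarrow> real set set \<Rightarrow> bool" where
  "interval_partition K X P \<longleftrightarrow>
     partition_on X P \<and> finite P \<and> card P \<le> K \<and> (\<forall>J\<in>P. nontrivial_interval J)"

definition monotone_or_antitone_on :: "real set \<Rightarrow> (real \<Rightarrow> real) \<Rightarrow> bool" where
  "monotone_or_antitone_on S f \<longleftrightarrow> mono_on S f \<or> antimono_on S f"

definition convex_concave_on :: "real set \<Rightarrow> (real \<Rightarrow> real) \<Rightarrow> bool" where
  "convex_concave_on S f \<longleftrightarrow> convex_on S f \<or> concave_on S f"

definition associated_partition :: "nat \<Rightarrow> real set \<Rightarrow> (real \<Rightarrow> real) \<Rightarrow> real set set \<Rightarrow> bool" where
  "associated_partition k X f P \<longleftrightarrow>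
     interval_partition k X P \<and>
     (\<forall>J\<in>P. monotone_or_antitone_on (closure J) f \<and> convex_concave_on (closure J) f)"

text \<open>Functions on \<open>X\<close> are represented by total functions; values outside \<open>X\<close> are irrelevant
  to every notion below.\<close>

definition class_C :: "nat \<Rightarrow> real set \<Rightarrow> (real \<Rightarrow> real) set" where
  "class_C k X = {f. continuous_on X f \<and> (\<exists>P. associated_partition k X f P)}"

definition affine_fun_on :: "real set \<Rightarrow> (real \<Rightarrow> real) \<Rightarrow> bool" where
  "affine_fun_on S f \<longleftrightarrow> (\<exists>c d. \<forall>x\<in>S. f x = c * x + d)"

definition piecewise_linear_on :: "nat \<Rightarrow> real set \<Rightarrow> (real \<Rightarrow> real) \<Rightarrow> bool" where
  "piecewise_linear_on K X f \<longleftrightarrow>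
     continuous_on X f \<and> (\<exists>P. interval_partition K X P \<and> (\<forall>J\<in>P. affine_fun_on J f))"

definition O_pl :: "nat \<Rightarrow> real set \<Rightarrow> nat \<Rightarrow> (real \<Rightarrow> real) set" where
  "O_pl k X K = {f \<in> class_C k X. piecewise_linear_on K X f}"

definition right_deriv :: "(real \<Rightarrow> real) \<Rightarrow> real \<Rightarrow> ereal" where
  "right_deriv f a = Lim (at_right a) (\<lambda>y. ereal ((f y - f a) / (y - a)))"

definition left_deriv :: "(real \<Rightarrow> real) \<Rightarrow> real \<Rightarrow> ereal" where
  "left_deriv f b = Lim (at_left b) (\<lambda>y. ereal ((f y - f b) / (y - b)))"

text \<open>Division with the convention \<open>0/0 = 1\<close>; in \<^typ>\<open>ereal\<close> already \<open>r / \<infinity> = 0\<close> for finite \<open>r\<close>.\<close>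

definition ratio :: "ereal \<Rightarrow> ereal \<Rightarrow> ereal" where
  "ratio u v = (if u = 0 \<and> v = 0 then 1 else u / v)"

text \<open>For \<open>f\<close> continuous, monotone and convex or concave on \<open>[a, b]\<close>, the slope
  \<open>\<bar>\<Delta>\<bar>\<close> lies between the minimum and the maximum below, so both ratios lie in \<open>[0, 1]\<close>
  and \<^const>\<open>real_of_ereal\<close> only changes the type.\<close>

definition linear_index :: "(real \<Rightarrow> real) \<Rightarrow> real \<Rightarrow> real \<Rightarrow> real" where
  "linear_index f a b =
     (let \<Delta> = ereal ((f b - f a) / (b - a));
          p = \<bar>right_deriv f a\<bar>; q = \<bar>left_deriv f b\<bar>
      in 1 - 1 / 2 * real_of_ereal (ratio (min p q) \<bar>\<Delta>\<bar> + ratio \<bar>\<Delta>\<bar> (max p q)))"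

definition num_points :: "nat \<Rightarrow> (nat \<Rightarrow> real) \<Rightarrow> real set \<Rightarrow> nat" where
  "num_points n x J = card {i \<in> {1..n}. x i \<in> J}"

definition variation_on :: "(real \<Rightarrow> real) \<Rightarrow> real set \<Rightarrow> real" where
  "variation_on f J = (SUP y\<in>J. f y) - (INF y\<in>J. f y)"

definition variation :: "real set set \<Rightarrow> (real \<Rightarrow> real) \<Rightarrow> real" where
  "variation P f = (\<Sum>J\<in>P. variation_on f J)"

text \<open>The closure of a bounded nontrivial interval \<open>J\<close> is \<open>[Inf J, Sup J]\<close>.\<close>

definition variation_index :: "nat \<Rightarrow> (nat \<Rightarrow> real) \<Rightarrow> real set set \<Rightarrow> (real \<Rightarrow> real) \<Rightarrow> real" where
  "variation_index n x P f =
     (\<Sum>J\<in>P. root 3 (real (num_points n x J) * variation_on f J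
                       * linear_index f (Inf J) (Sup J) / real n)) ^ 3"

end

theory Submission imports Defs begin

text \<open>Let \<open>f\<close> be convex and increasing on one element \<open>J\<close> of the partition; the other shapes
  follow by reflecting the axes. Interpolation of \<open>f\<close> at breakpoints keeps its shape and its values at
  the end points, so that the pieces can be glued. By the tangents at two successive
  breakpoints, the gap between chord and graph times the step \<open>l\<close> is at most \<open>l\<^sup>2 / 4\<close> times the
  increase of the slope, and also at most \<open>\<eta>\<^sup>2 / 4\<close> times the decrease of the inverse
  slope, where \<open>\<eta>\<close> is the increase of \<open>f\<close>. Taking \<open>D\<close> equal horizontal steps where the slope is
  below its mean and \<open>D\<close> equal vertical steps where it is above, both sums telescope, and the two
  end slopes combine to the linear index: the gaps at the \<open>n\<^sub>J\<close> design points sum to at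
  most \<open>n\<^sub>J V\<^sub>J \<Gamma>\<^sub>J / D\<^sup>2 + 2 V\<^sub>J\<close>. Finally \<open>D\<^sub>J\<close> is chosen just above \<open>\<gamma> s\<^sub>J / (\<Sum>J. s\<^sub>J)\<close>
  with \<open>s\<^sub>J = (n\<^sub>J V\<^sub>J \<Gamma>\<^sub>J / n)\<close> to the power \<open>1/3\<close>.\<close>

section \<open>Interpolation of convex functions\<close>

definition chord :: "(real \<Rightarrow> real) \<Rightarrow> real \<Rightarrow> real \<Rightarrow> real \<Rightarrow> real" where
  "chord f s t x = f s + (f t - f s) / (t - s) * (x - s)"

lemma chord_left [simp]: "chord f s t s = f s"
  by (simp add: chord_def)

lemma chord_right [simp]: "s < t \<Longrightarrow> chord f s t t = f t"
  by (simp add: chord_def)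

lemma chord_combination:
  "chord f s t ((1 - l) * x + l * y) = (1 - l) * chord f s t x + l * chord f s t y"
proof -
  have "s1 + m * ((1 - l) * x + l * y - s) = (1 - l) * (s1 + m * (x - s)) + l * (s1 + m * (y - s))"
    for s1 m :: real by (simp add: algebra_simps)
  then show ?thesis unfolding chord_def .
qed

lemma segment_coordinate:
  fixes x y t :: real
  assumes "x < y" "x \<le> t" "t \<le> y"
  obtains l where "0 \<le> l" "l \<le> 1" "t = (1 - l) * x + l * y" "(y - x) * l = t - x"
proof
  let ?l = "(t - x) / (y - x)"
  show "0 \<le> ?l" "?l \<le> 1" using assms by auto
  show e: "(y - x) * ?l = t - x" using assms by simp
  have "(1 - ?l) * x + ?l * y = x + (y - x) * ?l" by (simp only: left_diff_distrib) (simp add: mult.commute)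
  then show "t = (1 - ?l) * x + ?l * y" using e by simp
qed

lemma chord_mult: "s < t \<Longrightarrow> (t - s) * chord f s t x = f s * (t - x) + f t * (x - s)"
  by (simp add: chord_def field_simps)

text \<open>Convexity with denominators cleared, so that \<open>x = y\<close> is allowed. Letting
  each of three collinear positions in turn be the middle one gives the chord inequalities inside
  and outside a step.\<close>

lemma convex_on_three_points:
  fixes f :: "real \<Rightarrow> real"
  assumes "convex_on I f" "x \<in> I" "y \<in> I" "x \<le> t" "t \<le> y"
  shows "(y - x) * f t \<le> f x * (y - t) + f y * (t - x)"
proof (cases "x < y")
  case True
  obtain l where l: "0 \<le> l" "l \<le> 1" and t: "t = (1 - l) * x + l * y"
    and eq: "(y - x) * l = t - x"
    using segment_coordinate True assms(4,5) by metis
  have "f t \<le> (1 - l) * f x + l * f y"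
    using convex_onD[OF assms(1) l assms(2,3)] t by simp
  then have "(y - x) * f t \<le> (y - x) * ((1 - l) * f x + l * f y)"
    using True by (intro mult_left_mono) auto
  also have "\<dots> = (y - x) * f x + ((y - x) * l) * (f y - f x)" by (simp add: algebra_simps)
  also note eq
  finally show ?thesis by (simp add: algebra_simps)
next
  case False
  then have "t = x" "y = x" using assms by auto
  then show ?thesis by simp
qed

lemma convex_on_le_chord:
  assumes "convex_on I f" "s \<in> I" "t \<in> I" "s < t" "s \<le> x" "x \<le> t"
  shows "f x \<le> chord f s t x"
  using convex_on_three_points[OF assms(1-3,5,6)] chord_mult[OF assms(4), of f x] assms(4)
  by (smt (verit) mult_le_cancel_left_pos)

text \<open>Outside the step, the end point of the step nearest to \<open>x\<close> lies between
  \<open>x\<close> and the other end point, so the three-point inequality applies with that end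
  point in the middle.\<close>

lemma convex_on_chord_le:
  assumes "convex_on I f" "s \<in> I" "t \<in> I" "x \<in> I" "s < t" "x \<le> s \<or> t \<le> x"
  shows "chord f s t x \<le> f x"
proof -
  have "(t - s) * chord f s t x \<le> (t - s) * f x"
    using assms(6)
  proof
    assume "x \<le> s"
    then show ?thesis
      using convex_on_three_points[OF assms(1,4,3), of s] assms(5)
      by (simp only: chord_mult) (simp add: algebra_simps)
  next
    assume "t \<le> x"
    then show ?thesis
      using convex_on_three_points[OF assms(1,2,4), of t] assms(5)
      by (simp only: chord_mult) (simp add: algebra_simps)
  qed
  then show ?thesis using assms(5) by simp
qed

section \<open>Finite maxima of continuous and of convex functions\<close>

lemma continuous_on_Max:
  fixes c :: "'i \<Rightarrow> 'a::topological_space \<Rightarrow> 'b::linorder_topology"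
  assumes "finite I" "I \<noteq> {}" "\<And>i. i \<in> I \<Longrightarrow> continuous_on X (c i)"
  shows "continuous_on X (\<lambda>x. MAX i\<in>I. c i x)"
  using assms
proof (induction rule: finite_ne_induct)
  case (insert i I)
  have "(\<lambda>x. MAX j\<in>insert i I. c j x) = (\<lambda>x. max (c i x) (MAX j\<in>I. c j x))"
    using insert by (simp add: Max_insert)
  then show ?case using insert by (auto intro!: continuous_on_max)
qed simp

text \<open>At the intermediate point the maximum is attained by a single index \<open>j\<close>.
  Convexity of \<open>c j\<close> bounds it by the values of \<open>c j\<close> at the two outer
  points, which the maxima there dominate.\<close>

lemma convex_on_Max:
  fixes c :: "'i \<Rightarrow> real \<Rightarrow> real"
  assumes "finite I" "I \<noteq> {}" "convex X" "\<And>i. i \<in> I \<Longrightarrow> convex_on X (c i)"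
  shows "convex_on X (\<lambda>x. MAX i\<in>I. c i x)"
  using assms
proof (induction rule: finite_ne_induct)
  case (insert i I)
  show ?case
  proof (rule convex_onI)
    fix t x y :: real assume t: "0 < t" "t < 1" "x \<in> X" "y \<in> X"
    let ?z = "(1 - t) *\<^sub>R x + t *\<^sub>R y"
    have le: "c j z \<le> (MAX j\<in>insert i I. c j z)" if "j \<in> insert i I" for j z
      using insert that by (intro Max_ge) auto
    have "(MAX j\<in>insert i I. c j ?z) \<in> (\<lambda>j. c j ?z) ` insert i I"
      using insert by (intro Max_in) auto
    then obtain j where j: "j \<in> insert i I" "(MAX j\<in>insert i I. c j ?z) = c j ?z" by auto
    have "c j ?z \<le> (1 - t) * c j x + t * c j y"
      using insert.prems(2)[OF j(1)] t by (intro convex_onD) auto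
    also have "\<dots> \<le> (1 - t) * (MAX j\<in>insert i I. c j x) + t * (MAX j\<in>insert i I. c j y)"
      using t j(1) by (intro add_mono mult_left_mono le) auto
    finally show "(MAX j\<in>insert i I. c j ?z) \<le> \<dots>" using j by simp
  qed (use insert in auto)
qed simp

text \<open>If the first \<open>N\<close> steps do not yet reach \<open>x\<close>, or have not risen
  above \<open>t 0\<close>, then the last step must have positive length and contain
  \<open>x\<close>; otherwise induction applies.\<close>

lemma exists_nonzero_step_containing:
  fixes t :: "nat \<Rightarrow> real"
  assumes "t 0 \<le> x" "x \<le> t N" "t 0 < t N"
  shows "\<exists>i<N. t i < t (Suc i) \<and> x \<in> {t i..t (Suc i)}"
  using assms
proof (induction N)
  case (Suc N)
  show ?case
  proof (cases "x \<le> t N \<and> t 0 < t N")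
    case True
    then show ?thesis using Suc by (auto intro: less_SucI)
  next
    case False
    then have "t N < t (Suc N)" "t N \<le> x" using Suc.prems by linarith+
    then show ?thesis using Suc.prems by auto
  qed
qed simp

text \<open>Steps of zero length are allowed. The interpolant is the maximum of the chords over the
  other steps, which makes its convexity, continuity and monotonicity immediate.\<close>

lemma convex_interpolation:
  fixes f :: "real \<Rightarrow> real" and t :: "nat \<Rightarrow> real"
  assumes f: "convex_on {u..v} f" "mono_on {u..v} f"
    and t: "mono_on {..N} t" "t 0 = u" "t N = v" and uv: "u < v"
  obtains g where "convex_on {u..v} g" "mono_on {u..v} g" "continuous_on {u..v} g"
    "\<And>i x. i < N \<Longrightarrow> t i < t (Suc i) \<Longrightarrow> x \<in> {t i..t (Suc i)} \<Longrightarrow> g x = chord f (t i) (t (Suc i)) x"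
proof -
  define I where "I = {i. i < N \<and> t i < t (Suc i)}"
  define c where "c i = chord f (t i) (t (Suc i))" for i
  define g where "g x = (MAX i\<in>I. c i x)" for x
  have fin: "finite I" by (simp add: I_def)
  obtain i0 where "i0 < N" "t i0 < t (Suc i0)"
    using exists_nonzero_step_containing[of t u N] t uv by auto
  then have ne: "I \<noteq> {}" by (auto simp: I_def)
  have tin: "t i \<in> {u..v}" if "i \<le> N" for i
    using that monotone_onD[OF t(1), of 0 i] monotone_onD[OF t(1), of i N] t(2,3) by auto
  have tle: "t i \<le> t j" if "i \<le> j" "j \<le> N" for i j
    using that monotone_onD[OF t(1), of i j] by auto
  have slope: "0 \<le> (f (t (Suc i)) - f (t i)) / (t (Suc i) - t i)" if "i \<in> I" for i
    using that tin[of i] tin[of "Suc i"] monotone_onD[OF f(2), of "t i" "t (Suc i)"]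
    by (auto simp: I_def)
  \<comment> \<open>No breakpoint lies strictly inside step \<open>j\<close>, so at every breakpoint
    the extended chord over that step is below the graph.\<close>
  have below: "c j (t i) \<le> f (t i)" if "j \<in> I" "i \<le> N" for i j
  proof -
    have "t i \<le> t j \<or> t (Suc j) \<le> t i"
      using that tle[of i j] tle[of "Suc j" i] by (cases "i \<le> j") (auto simp: I_def)
    then show ?thesis
      unfolding c_def using that tin[of i] tin[of j] tin[of "Suc j"]
      by (intro convex_on_chord_le[OF f(1)]) (auto simp: I_def)
  qed
  \<comment> \<open>Both chords are affine, so on step \<open>i\<close> it suffices to compare them
    at its two ends. There \<open>c i\<close> equals \<open>f\<close> and \<open>c j\<close> is at
    most \<open>f\<close>.\<close>
  have top: "c j x \<le> c i x" if "i \<in> I" "j \<in> I" "x \<in> {t i..t (Suc i)}" for i j x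
  proof -
    have lt: "t i < t (Suc i)" using that by (simp add: I_def)
    obtain l where l: "0 \<le> l" "l \<le> 1" and x: "x = (1 - l) * t i + l * t (Suc i)"
      using segment_coordinate lt \<open>x \<in> _\<close> by (metis atLeastAtMost_iff)
    have "c j x = (1 - l) * c j (t i) + l * c j (t (Suc i))"
      unfolding c_def by (subst x) (rule chord_combination)
    also have "\<dots> \<le> (1 - l) * f (t i) + l * f (t (Suc i))"
      using that l by (intro add_mono mult_left_mono below) (auto simp: I_def)
    also have "\<dots> = (1 - l) * c i (t i) + l * c i (t (Suc i))" using lt by (simp add: c_def)
    also have "\<dots> = c i x" unfolding c_def chord_combination[symmetric] x[symmetric] ..
    finally show ?thesis .
  qed
  show thesis
  proof
    have "convex_on {u..v} (c i)" for i
      by (rule convex_onI) (auto simp: c_def chord_combination)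
    then show "convex_on {u..v} g"
      unfolding g_def using fin ne by (intro convex_on_Max) auto
    have "continuous_on {u..v} (c i)" for i
      unfolding c_def chord_def by (intro continuous_intros)
    then show "continuous_on {u..v} g"
      unfolding g_def using fin ne by (intro continuous_on_Max) auto
    show "mono_on {u..v} g"
    proof (rule mono_onI)
      fix x y :: real assume "x \<le> y"
      have "c i x \<le> g y" if "i \<in> I" for i
      proof -
        have "c i x \<le> c i y"
          unfolding c_def chord_def using slope[OF that] \<open>x \<le> y\<close>
          by (intro add_left_mono mult_left_mono) auto
        also have "\<dots> \<le> g y" unfolding g_def using fin that by (intro Max_ge) auto
        finally show ?thesis .
      qed
      then show "g x \<le> g y" unfolding g_def[of x] using fin ne by (subst Max_le_iff) auto
    qed
    fix i x assume "i < N" "t i < t (Suc i)" "x \<in> {t i..t (Suc i)}"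
    then have i: "i \<in> I" "x \<in> {t i..t (Suc i)}" by (auto simp: I_def)
    then have "g x = c i x"
      unfolding g_def using fin top by (intro Max_eqI) auto
    then show "g x = chord f (t i) (t (Suc i)) x" by (simp add: c_def)
  qed
qed

section \<open>The gap between a convex function and its chords\<close>

definition separated :: "real \<Rightarrow> real set \<Rightarrow> bool" where
  "separated \<delta> S \<longleftrightarrow> (\<forall>x\<in>S. \<forall>y\<in>S. x \<noteq> y \<longrightarrow> \<delta> \<le> \<bar>x - y\<bar>)"

text \<open>Cut the line into half-open cells of length \<open>\<delta>\<close> starting at
  \<open>s\<close>. Two points in one cell would be closer than \<open>\<delta>\<close>, so the cell
  number \<open>\<phi>\<close> is injective, and only the cells numbered from 0 to
  \<open>\<lfloor>(t - s) / \<delta>\<rfloor>\<close> occur.\<close>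

lemma card_separated_Icc:
  assumes "separated \<delta> S" "0 < \<delta>" "s \<le> t"
  shows "real (card (S \<inter> {s..t})) \<le> (t - s) / \<delta> + 1"
proof -
  define \<phi> where "\<phi> x = nat \<lfloor>(x - s) / \<delta>\<rfloor>" for x
  have "inj_on \<phi> (S \<inter> {s..t})"
  proof (rule inj_onI, rule ccontr)
    fix x y assume xy: "x \<in> S \<inter> {s..t}" "y \<in> S \<inter> {s..t}" "\<phi> x = \<phi> y" "x \<noteq> y"
    have "0 \<le> (x - s) / \<delta>" "0 \<le> (y - s) / \<delta>" using xy assms(2) by auto
    then have "\<lfloor>(x - s) / \<delta>\<rfloor> = \<lfloor>(y - s) / \<delta>\<rfloor>"
      using xy(3) unfolding \<phi>_def by (metis int_nat_eq zero_le_floor)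
    then have "\<bar>(x - s) / \<delta> - (y - s) / \<delta>\<bar> < 1" by linarith
    moreover have "(x - s) / \<delta> - (y - s) / \<delta> = (x - y) / \<delta>" by (simp add: diff_divide_distrib)
    ultimately have "\<bar>x - y\<bar> < \<delta>" using assms(2) by (simp add: field_simps abs_divide)
    moreover have "\<delta> \<le> \<bar>x - y\<bar>" using xy assms(1) by (auto simp: separated_def)
    ultimately show False by simp
  qed
  moreover have "\<phi> ` (S \<inter> {s..t}) \<subseteq> {..nat \<lfloor>(t - s) / \<delta>\<rfloor>}"
    using assms(2) unfolding \<phi>_def
    by (auto intro!: nat_mono floor_mono divide_right_mono)
  ultimately have "card (S \<inter> {s..t}) \<le> card {..nat \<lfloor>(t - s) / \<delta>\<rfloor>}"
    by (intro card_inj_on_le) auto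
  then have "card (S \<inter> {s..t}) \<le> nat \<lfloor>(t - s) / \<delta>\<rfloor> + 1" by simp
  moreover have "real (nat \<lfloor>(t - s) / \<delta>\<rfloor>) \<le> (t - s) / \<delta>" using assms by simp
  ultimately show ?thesis by linarith
qed

text \<open>There are at most \<open>(t - s) / \<delta> + 1\<close> summands. The bound
  \<open>E\<close> on length times height pays for the first term of this count, and the bound
  \<open>B\<close> on the height alone pays for the extra point.\<close>

lemma sum_separated_Icc_le:
  assumes "separated \<delta> S" "0 < \<delta>" "s \<le> t" "finite S"
    and h: "\<And>x. x \<in> {s..t} \<Longrightarrow> 0 \<le> h x" "\<And>x. x \<in> {s..t} \<Longrightarrow> h x \<le> B"
      "\<And>x. x \<in> {s..t} \<Longrightarrow> (t - s) * h x \<le> E"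
  shows "(\<Sum>x\<in>S \<inter> {s..t}. h x) \<le> E / \<delta> + B"
proof (cases "S \<inter> {s..t} = {}")
  case True
  have "0 \<le> B" using h(1)[of s] h(2)[of s] assms(3) by simp
  moreover have "0 \<le> E"
  proof -
    have "0 \<le> (t - s) * h s" using h(1)[of s] assms(3) by simp
    also have "\<dots> \<le> E" using assms(3) by (intro h(3)) simp
    finally show ?thesis .
  qed
  ultimately show ?thesis using True assms(2) by simp
next
  case False
  define M where "M = Max (h ` (S \<inter> {s..t}))"
  have "M \<in> h ` (S \<inter> {s..t})" unfolding M_def using False assms(4) by (intro Max_in) auto
  then obtain z where z: "z \<in> {s..t}" "M = h z" by auto
  have "(\<Sum>x\<in>S \<inter> {s..t}. h x) \<le> (\<Sum>x\<in>S \<inter> {s..t}. M)"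
    unfolding M_def using assms(4) by (intro sum_mono Max_ge) auto
  also have "\<dots> = real (card (S \<inter> {s..t})) * M" by simp
  also have "\<dots> \<le> ((t - s) / \<delta> + 1) * M"
    using z h(1) by (intro mult_right_mono card_separated_Icc assms) auto
  also have "\<dots> = ((t - s) * M) / \<delta> + M" by (simp add: algebra_simps)
  also have "\<dots> \<le> E / \<delta> + B" using z h(2,3)[OF z(1)] assms(2) by (intro add_mono divide_right_mono) auto
  finally show ?thesis .
qed

lemma mult_diff_le_quarter_square:
  fixes x y :: real
  shows "(y - x) * x \<le> y\<^sup>2 / 4"
  using zero_le_power2[of "y - 2 * x"] by (simp add: power2_eq_square algebra_simps)

text \<open>Here \<open>r\<close> and \<open>q\<close> are slopes of supporting lines at
  \<open>s\<close> and \<open>t\<close>. The line at \<open>t\<close> turns length times gap into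
  \<open>(l - X) * (q * X - Y)\<close>, the line at \<open>s\<close> then gives
  \<open>(q - r) * (l - X) * X\<close>, and the product of the two parts of \<open>l\<close> is at
  most \<open>l\<^sup>2 / 4\<close>.\<close>

lemma chord_gap_le_slopes:
  assumes "s < t" "s \<le> x" "x \<le> t"
    and r: "f s + r * (x - s) \<le> f x" and q: "f t - q * (t - x) \<le> f x"
    and rq: "f s + r * (t - s) \<le> f t" "f t - q * (t - s) \<le> f s"
  shows "(t - s) * (chord f s t x - f x) \<le> (t - s)\<^sup>2 * (q - r) / 4"
proof -
  define X Y \<eta> l where "X = x - s" "Y = f x - f s" "\<eta> = f t - f s" "l = t - s"
  note d = this
  have l: "0 \<le> X" "X \<le> l" "0 < l" using assms by (auto simp: d)
  \<comment> \<open>Each supporting line evaluated at the other end of the step compares the two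
    slopes.\<close>
  have "r * l \<le> q * l" using rq by (simp add: d algebra_simps)
  then have "r \<le> q" using l by simp
  have Y: "r * X \<le> Y" "\<eta> - Y \<le> q * (l - X)" using r q by (auto simp: d)
  have "(t - s) * (chord f s t x - f x) = \<eta> * X - l * Y"
    using chord_mult[OF assms(1), of f x] by (simp add: d algebra_simps)
  also have "\<dots> \<le> (Y + q * (l - X)) * X - l * Y"
    using Y l by (intro diff_right_mono mult_right_mono) auto
  also have "\<dots> = (l - X) * (q * X - Y)" by (simp add: algebra_simps)
  also have "\<dots> \<le> (l - X) * (q * X - r * X)" using Y l by (intro mult_left_mono) auto
  also have "\<dots> = (q - r) * ((l - X) * X)" by (simp add: algebra_simps)
  also have "\<dots> \<le> (q - r) * (l\<^sup>2 / 4)"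
    using \<open>r \<le> q\<close> by (intro mult_left_mono mult_diff_le_quarter_square) auto
  finally show ?thesis by (simp add: d mult.commute)
qed

text \<open>The same estimate with the roles of the two axes exchanged: \<open>\<rho>\<close> and \<open>\<sigma>\<close> are
  inverse slopes, and \<open>\<sigma> = 0\<close> stands for an infinite slope.\<close>

lemma chord_gap_le_inverse_slopes:
  assumes "s < t" "f s \<le> f x" "f x \<le> f t" "f s < f t"
    and r: "x - s \<le> \<rho> * (f x - f s)" and q: "\<sigma> * (f t - f x) \<le> t - x"
    and rq: "t - s \<le> \<rho> * (f t - f s)" "\<sigma> * (f t - f s) \<le> t - s"
  shows "(t - s) * (chord f s t x - f x) \<le> (f t - f s)\<^sup>2 * (\<rho> - \<sigma>) / 4"
proof -
  define X Y \<eta> l where "X = x - s" "Y = f x - f s" "\<eta> = f t - f s" "l = t - s"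
  note d = this
  have l: "0 \<le> Y" "Y \<le> \<eta>" "0 < \<eta>" using assms by (auto simp: d)
  have "\<sigma> * \<eta> \<le> \<rho> * \<eta>" using rq by (simp add: d)
  then have "\<sigma> \<le> \<rho>" using l by simp
  have X: "X \<le> \<rho> * Y" "X + \<sigma> * (\<eta> - Y) \<le> l" using r q by (auto simp: d algebra_simps)
  have "(t - s) * (chord f s t x - f x) = \<eta> * X - l * Y"
    using chord_mult[OF assms(1), of f x] by (simp add: d algebra_simps)
  also have "\<dots> \<le> \<eta> * X - (X + \<sigma> * (\<eta> - Y)) * Y"
    using X l by (intro diff_left_mono mult_right_mono) auto
  also have "\<dots> = (\<eta> - Y) * (X - \<sigma> * Y)" by (simp add: algebra_simps)
  also have "\<dots> \<le> (\<eta> - Y) * (\<rho> * Y - \<sigma> * Y)" using X l by (intro mult_left_mono) auto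
  also have "\<dots> = (\<rho> - \<sigma>) * ((\<eta> - Y) * Y)" by (simp add: algebra_simps)
  also have "\<dots> \<le> (\<rho> - \<sigma>) * (\<eta>\<^sup>2 / 4)"
    using \<open>\<sigma> \<le> \<rho>\<close> by (intro mult_left_mono mult_diff_le_quarter_square) auto
  finally show ?thesis by (simp add: d mult.commute)
qed

section \<open>Telescoping gap bounds for equal steps on either axis\<close>

lemma convex_on_subgradient:
  fixes f :: "real \<Rightarrow> real"
  assumes "convex_on {u..v} f" "u < t" "t < v"
  obtains s where "\<And>x. x \<in> {u..v} \<Longrightarrow> f t + s * (x - t) \<le> f x"
\<comment> \<open>The witness is the right derivative at \<open>t\<close>, written as the infimum of
  the difference quotients to the right.\<close>
proof
  fix x assume "x \<in> {u..v}"
  then show "f t + Inf ((\<lambda>y. (f t - f y) / (t - y)) ` ({t<..} \<inter> {u..v})) * (x - t) \<le> f x"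
    using convex_le_Inf_differential[OF assms(1), of t x] assms(2,3) by simp
qed

text \<open>The gap is multiplied by the length of the step because the number of design points in a
  step grows with that length. A step of zero length has no chord; \<open>0 \<le> E\<close> keeps
  its contribution to sums of bounds harmless.\<close>

definition chord_gap_bounded :: "(real \<Rightarrow> real) \<Rightarrow> real \<Rightarrow> real \<Rightarrow> real \<Rightarrow> bool" where
  "chord_gap_bounded f s t E \<longleftrightarrow>
     0 \<le> E \<and> (s < t \<longrightarrow> (\<forall>x\<in>{s..t}. (t - s) * (chord f s t x - f x) \<le> E))"

lemma chord_gap_boundedI:
  assumes "s < t" "\<And>x. x \<in> {s..t} \<Longrightarrow> (t - s) * (chord f s t x - f x) \<le> E"
  shows "chord_gap_bounded f s t E"
  using assms(2)[of s] assms by (auto simp: chord_gap_bounded_def)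

text \<open>Choose a supporting slope at every breakpoint, with \<open>p\<close> at \<open>u\<close>
  and \<open>m\<close> at \<open>w\<close>. All steps have the same length, so the bounds are a
  common factor times successive differences of slopes, and their sum sees only
  \<open>m - p\<close>.\<close>

lemma equal_steps_gap:
  fixes f :: "real \<Rightarrow> real"
  assumes f: "convex_on {u..v} f" and w: "u \<le> w" "w \<le> v" and D: "0 < D"
    and p: "\<And>x. x \<in> {u..v} \<Longrightarrow> f u + p * (x - u) \<le> f x"
    and m: "\<And>x. x \<in> {u..v} \<Longrightarrow> f w + m * (x - w) \<le> f x"
    and t: "\<And>i. i \<le> D \<Longrightarrow> t i = u + (w - u) * (real i / real D)"
  obtains E where "\<And>i. i < D \<Longrightarrow> chord_gap_bounded f (t i) (t (Suc i)) (E i)"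
    "(\<Sum>i<D. E i) = (w - u)\<^sup>2 * (m - p) / (4 * (real D)\<^sup>2)"
proof (cases "u = w")
  case True
  show thesis
    by (rule that[of "\<lambda>_. 0"]) (auto simp: chord_gap_bounded_def True t)
next
  case False
  then have uw: "u < w" using w by simp
  have t0: "t 0 = u" and tD: "t D = w" using D by (auto simp: t)
  have ti: "u < t i \<and> t i < w" if "0 < i" "i < D" for i
  proof -
    have "(w - u) * (real i / real D) < (w - u) * 1"
      using uw that by (intro mult_strict_left_mono) auto
    then show ?thesis using uw that by (auto simp: t)
  qed
  \<comment> \<open>The slopes at both ends are prescribed so that the telescoping sum ends in
    exactly \<open>p\<close> and \<open>m\<close>. Indices beyond \<open>D\<close> are
    unconstrained, which allows the choice of one total sequence.\<close>
  have "\<exists>s. (i = 0 \<longrightarrow> s = p) \<and> (i = D \<longrightarrow> s = m) \<and>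
      (i \<le> D \<longrightarrow> (\<forall>x\<in>{u..v}. f (t i) + s * (x - t i) \<le> f x))" for i
  proof -
    consider "i = 0" | "i = D" | "0 < i" "i < D" | "i > D" by linarith
    then show ?thesis
    proof cases
      case 3
      have "u < t i" "t i < v" using ti[OF 3] w by auto
      then obtain s where "\<And>x. x \<in> {u..v} \<Longrightarrow> f (t i) + s * (x - t i) \<le> f x"
        using convex_on_subgradient[OF f] by blast
      then have "\<forall>x\<in>{u..v}. f (t i) + s * (x - t i) \<le> f x" by blast
      then show ?thesis using 3 by blast
    qed (use D p m t0 tD in auto)
  qed
  then obtain s where s: "s 0 = p" "s D = m"
    "\<And>i x. i \<le> D \<Longrightarrow> x \<in> {u..v} \<Longrightarrow> f (t i) + s i * (x - t i) \<le> f x"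
    by metis
  have diff: "t (Suc i) - t i = (w - u) / D" if "i < D" for i
    using that by (simp add: t field_simps)
  have tv: "t i \<in> {u..v}" if "i \<le> D" for i
    using ti[of i] that t0 tD w by (cases "i = 0 \<or> i = D") auto
  show thesis
  proof
    fix i assume i: "i < D"
    have "0 < (w - u) / D" using uw D by simp
    then have lt: "t i < t (Suc i)" using diff[OF i] by simp
    show "chord_gap_bounded f (t i) (t (Suc i)) (((w - u) / D)\<^sup>2 * (s (Suc i) - s i) / 4)"
    proof (rule chord_gap_boundedI[OF lt])
      fix x assume x: "x \<in> {t i..t (Suc i)}"
      then have xv: "x \<in> {u..v}" using tv[of i] tv[of "Suc i"] i by auto
      have "f (t (Suc i)) - s (Suc i) * (t (Suc i) - y) \<le> f y" if "y \<in> {u..v}" for y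
        using s(3)[of "Suc i" y] i that by (simp add: algebra_simps)
      then show "(t (Suc i) - t i) * (chord f (t i) (t (Suc i)) x - f x)
          \<le> ((w - u) / D)\<^sup>2 * (s (Suc i) - s i) / 4"
        unfolding diff[OF i, symmetric]
        using i x xv lt tv[of i] tv[of "Suc i"]
        by (intro chord_gap_le_slopes s) auto
    qed
  next
    have "(\<Sum>i<D. ((w - u) / D)\<^sup>2 * (s (Suc i) - s i) / 4) =
        ((w - u) / D)\<^sup>2 / 4 * (\<Sum>i<D. s (Suc i) - s i)"
      by (simp add: sum_distrib_left)
    also have "\<dots> = (w - u)\<^sup>2 * (m - p) / (4 * (real D)\<^sup>2)"
      by (simp add: sum_lessThan_telescope s power_divide)
    finally show "(\<Sum>i<D. ((w - u) / D)\<^sup>2 * (s (Suc i) - s i) / 4) =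
      (w - u)\<^sup>2 * (m - p) / (4 * (real D)\<^sup>2)" .
  qed
qed

text \<open>The counterpart with equal increments of height. The inverse slopes \<open>r i\<close>
  run from \<open>1 / m\<close> at \<open>w\<close> to \<open>\<rho>\<close> at \<open>v\<close>, so
  that the telescoping sum is \<open>1 / m - \<rho>\<close>; an infinite slope at \<open>v\<close>
  corresponds to \<open>\<rho> = 0\<close>.\<close>

lemma equal_levels_gap:
  fixes f :: "real \<Rightarrow> real"
  assumes f: "convex_on {u..v} f" "mono_on {u..v} f"
    and w: "u \<le> w" "w \<le> v" and D: "0 < D" and m0: "0 < m"
    and m: "\<And>x. x \<in> {u..v} \<Longrightarrow> f w + m * (x - w) \<le> f x"
    and \<rho>: "\<And>x. x \<in> {u..v} \<Longrightarrow> \<rho> * (f v - f x) \<le> v - x"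
    and t: "\<And>i. i \<le> D \<Longrightarrow> t i \<in> {w..v}" "t 0 = w" "t D = v"
    and ft: "\<And>i. i \<le> D \<Longrightarrow> f (t i) = f w + (f v - f w) * (real i / real D)"
  obtains E where "mono_on {..D} t" "\<And>i. i < D \<Longrightarrow> chord_gap_bounded f (t i) (t (Suc i)) (E i)"
    "(\<Sum>i<D. E i) = (f v - f w)\<^sup>2 * (1 / m - \<rho>) / (4 * (real D)\<^sup>2)"
proof (cases "w = v")
  case True
  then have "t i = v" if "i \<le> D" for i using t(1)[OF that] by auto
  then show thesis
    by (intro that[of "\<lambda>_. 0"]) (auto simp: chord_gap_bounded_def True intro!: mono_onI)
next
  case False
  then have wv: "w < v" using w by simp
  \<comment> \<open>The positive supporting slope at \<open>w\<close> forces a positive total rise.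
    The levels are therefore distinct, and by monotonicity so are the breakpoints, in the same
    order.\<close>
  have "0 < m * (v - w)" using m0 wv by simp
  then have fwv: "f w < f v" using m[of v] w by auto
  have flt: "f (t i) < f (t j)" if "i < j" "j \<le> D" for i j
  proof -
    have "(f v - f w) * (real i / real D) < (f v - f w) * (real j / real D)"
      using that fwv D by (intro mult_strict_left_mono divide_strict_right_mono) auto
    then show ?thesis using that by (simp add: ft)
  qed
  have tuv: "t i \<in> {u..v}" if "i \<le> D" for i using t(1)[OF that] w by auto
  have tlt: "t i < t j" if "i < j" "j \<le> D" for i j
  proof (rule ccontr)
    assume "\<not> t i < t j"
    then have "f (t j) \<le> f (t i)"
      using that tuv[of i] tuv[of j] by (intro monotone_onD[OF f(2)]) auto
    then show False using flt[OF that] by simp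
  qed
  have "\<exists>r. (i = 0 \<longrightarrow> r = 1 / m) \<and> (i = D \<longrightarrow> r = \<rho>) \<and>
      (i \<le> D \<longrightarrow> (\<forall>x\<in>{u..v}. x - t i \<le> r * (f x - f (t i))))" for i
  proof -
    consider "i = 0" | "i = D" | "0 < i" "i < D" | "i > D" by linarith
    then show ?thesis
    proof cases
      case 1
      have "x - t i \<le> 1 / m * (f x - f (t i))" if "x \<in> {u..v}" for x
        using m[OF that] m0 t(2) 1 by (simp add: field_simps)
      then show ?thesis using 1 D by auto
    next
      case 2
      then show ?thesis using \<rho> D t by (auto simp: algebra_simps)
    next
      case 3
      have tw: "w < t i" "t i < v" using tlt[of 0 i] tlt[of i D] 3 t by auto
      then obtain s where s: "\<And>x. x \<in> {u..v} \<Longrightarrow> f (t i) + s * (x - t i) \<le> f x"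
        using convex_on_subgradient[OF f(1), of "t i"] w by force
      \<comment> \<open>Evaluating the supporting line at \<open>w\<close>, where \<open>f\<close>
        is strictly smaller, shows that its slope is positive and can be inverted.\<close>
      have "f (t i) + s * (w - t i) \<le> f w" using s w by simp
      moreover have "f w < f (t i)" using flt[of 0 i] 3 t by auto
      ultimately have "s * (w - t i) < 0" by linarith
      then have "0 < s" using tw by (simp add: mult_less_0_iff)
      have "x - t i \<le> (1 / s) * (f x - f (t i))" if "x \<in> {u..v}" for x
        using s[OF that] \<open>0 < s\<close> by (simp add: field_simps)
      then show ?thesis using 3 by blast
    qed auto
  qed
  then obtain r where r: "r 0 = 1 / m" "r D = \<rho>"
    "\<And>i x. i \<le> D \<Longrightarrow> x \<in> {u..v} \<Longrightarrow> x - t i \<le> r i * (f x - f (t i))"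
    by metis
  have diff: "f (t (Suc i)) - f (t i) = (f v - f w) / D" if "i < D" for i
  proof -
    have "f (t (Suc i)) - f (t i) = (f v - f w) * (real (Suc i) / real D - real i / real D)"
      using that by (simp add: ft algebra_simps)
    also have "real (Suc i) / real D - real i / real D = 1 / D"
      by (simp add: diff_divide_distrib[symmetric])
    finally show ?thesis by simp
  qed
  show thesis
  proof
    show "mono_on {..D} t" using tlt by (intro mono_onI) (force simp: le_less)
  next
    fix i assume i: "i < D"
    have lt: "t i < t (Suc i)" "f (t i) < f (t (Suc i))" using tlt flt i by auto
    show "chord_gap_bounded f (t i) (t (Suc i)) (((f v - f w) / D)\<^sup>2 * (r i - r (Suc i)) / 4)"
    proof (rule chord_gap_boundedI[OF lt(1)])
      fix x assume x: "x \<in> {t i..t (Suc i)}"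
      then have xv: "x \<in> {u..v}" using tuv[of i] tuv[of "Suc i"] i by auto
      have "r (Suc i) * (f (t (Suc i)) - f y) \<le> t (Suc i) - y" if "y \<in> {u..v}" for y
        using r(3)[of "Suc i" y] i that by (simp add: algebra_simps)
      moreover have "f (t i) \<le> f x" "f x \<le> f (t (Suc i))"
        using x xv tuv[of i] tuv[of "Suc i"] i by (auto intro!: monotone_onD[OF f(2)])
      ultimately show "(t (Suc i) - t i) * (chord f (t i) (t (Suc i)) x - f x)
          \<le> ((f v - f w) / D)\<^sup>2 * (r i - r (Suc i)) / 4"
        unfolding diff[OF i, symmetric]
        using i x xv lt tuv[of i] tuv[of "Suc i"]
        by (intro chord_gap_le_inverse_slopes r) auto
    qed
  next
    have "(\<Sum>i<D. ((f v - f w) / D)\<^sup>2 * (r i - r (Suc i)) / 4) =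
        ((f v - f w) / D)\<^sup>2 / 4 * (\<Sum>i<D. r i - r (Suc i))"
      by (simp add: sum_distrib_left)
    also have "\<dots> = (f v - f w)\<^sup>2 * (1 / m - \<rho>) / (4 * (real D)\<^sup>2)"
      by (simp add: sum_lessThan_telescope' r power_divide)
    finally show "(\<Sum>i<D. ((f v - f w) / D)\<^sup>2 * (r i - r (Suc i)) / 4) =
      (f v - f w)\<^sup>2 * (1 / m - \<rho>) / (4 * (real D)\<^sup>2)" .
  qed
qed

section \<open>End slopes and the linear index\<close>

text \<open>One-sided derivatives are recorded as actual limits: \<open>right_deriv\<close> and
  \<open>left_deriv\<close> are defined by \<open>Lim\<close>, whose value is only informative once
  convergence is known.\<close>

definition has_end_slopes :: "(real \<Rightarrow> real) \<Rightarrow> real \<Rightarrow> real \<Rightarrow> ereal \<Rightarrow> ereal \<Rightarrow> bool" where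
  "has_end_slopes f u v p q \<longleftrightarrow>
     ((\<lambda>y. ereal ((f y - f u) / (y - u))) \<longlongrightarrow> p) (at_right u) \<and>
     ((\<lambda>y. ereal ((f y - f v) / (y - v))) \<longlongrightarrow> q) (at_left v)"

lemma linear_index_eq:
  assumes "has_end_slopes f u v p q"
  shows "linear_index f u v = 1 - 1 / 2 * real_of_ereal
    (ratio (min \<bar>p\<bar> \<bar>q\<bar>) (ereal \<bar>(f v - f u) / (v - u)\<bar>) +
     ratio (ereal \<bar>(f v - f u) / (v - u)\<bar>) (max \<bar>p\<bar> \<bar>q\<bar>))"
proof -
  have "right_deriv f u = p" "left_deriv f v = q"
    using assms unfolding right_deriv_def left_deriv_def has_end_slopes_def
    by (auto intro!: tendsto_Lim)
  then show ?thesis unfolding linear_index_def Let_def by simp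
qed

section \<open>Invariance of end slopes and linear index under reflection of the axes\<close>

lemma has_end_slopes_uminus:
  assumes "has_end_slopes f u v p q"
  shows "has_end_slopes (\<lambda>x. - f x) u v (- p) (- q)"
proof -
  have eq: "ereal ((- f y - - f w) / (y - w)) = - ereal ((f y - f w) / (y - w))" for y w
    by (simp add: minus_divide_left)
  show ?thesis
    using assms unfolding has_end_slopes_def eq by (intro conjI tendsto_uminus_ereal) auto
qed

lemma has_end_slopes_reflect:
  assumes "has_end_slopes f u v p q"
  shows "has_end_slopes (\<lambda>x. f (- x)) (- v) (- u) (- q) (- p)"
proof -
  have eq: "ereal ((f y - f w) / (- y - - w)) = - ereal ((f y - f w) / (y - w))" for y w
    using minus_divide_right[of "f y - f w" "y - w"] by simp
  show ?thesis
    using assms unfolding has_end_slopes_def at_right_minus[of "- v"] at_left_minus[of "- u"]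
      filterlim_filtermap minus_minus eq
    by (intro conjI tendsto_uminus_ereal) auto
qed

lemma linear_index_uminus:
  assumes "has_end_slopes f u v p q"
  shows "linear_index (\<lambda>x. - f x) u v = linear_index f u v"
proof -
  have abs_eq: "\<bar>(- f v - - f u) / (v - u)\<bar> = \<bar>(f v - f u) / (v - u)\<bar>"
    by (simp add: abs_divide abs_minus_commute)
  then show ?thesis
    unfolding linear_index_eq[OF assms] linear_index_eq[OF has_end_slopes_uminus[OF assms]] abs_eq by simp
qed

text \<open>Reflection of the domain exchanges the two end slopes and flips their signs. The index
  depends only on the minimum and maximum of their absolute values.\<close>

lemma linear_index_reflect:
  assumes "has_end_slopes f u v p q"
  shows "linear_index (\<lambda>x. f (- x)) (- v) (- u) = linear_index f u v"
proof -
  have abs_eq: "\<bar>(f (- (- u)) - f (- (- v))) / (- u - - v)\<bar> = \<bar>(f v - f u) / (v - u)\<bar>"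
    by (simp add: abs_divide abs_minus_commute)
  then show ?thesis
    unfolding linear_index_eq[OF assms] linear_index_eq[OF has_end_slopes_reflect[OF assms]] abs_eq
    by (simp add: min.commute max.commute)
qed

text \<open>By convexity the difference quotients from either end are monotone, so the end slopes
  exist as an infimum and a supremum. They enclose the mean slope \<open>d\<close>, which resolves
  the minimum and maximum in the index. The slope at \<open>u\<close> is a real number
  \<open>r\<close>; the one at \<open>v\<close> may be infinite and is represented by its inverse
  \<open>\<sigma>\<close>.\<close>

lemma convex_mono_end_slopes:
  fixes f :: "real \<Rightarrow> real"
  assumes uv: "u < v" and f: "convex_on {u..v} f" "mono_on {u..v} f" "f u < f v"
  defines "d \<equiv> (f v - f u) / (v - u)"
  obtains p q r \<sigma> where "has_end_slopes f u v p q" "linear_index f u v = 1 - (r / d + d * \<sigma>) / 2"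
    "0 \<le> r" "r \<le> d" "0 \<le> \<sigma>" "\<sigma> * d \<le> 1"
    "\<And>x. x \<in> {u..v} \<Longrightarrow> f u + r * (x - u) \<le> f x"
    "\<And>x. x \<in> {u..v} \<Longrightarrow> \<sigma> * (f v - f x) \<le> v - x"
proof -
  have d: "0 < d" using uv f by (simp add: d_def)
  define \<phi> where "\<phi> y = (f y - f u) / (y - u)" for y
  define \<psi> where "\<psi> y = ereal ((f y - f v) / (y - v))" for y
  have \<phi>mono: "\<phi> x \<le> \<phi> y" if "x \<in> {u..v}" "y \<in> {u..v}" "u < x" "x \<le> y" for x y
  proof (cases "x = y")
    case False
    have "(f u - f x) / (u - x) \<le> (f u - f y) / (u - y)"
      using that False uv by (intro convex_on_slope_le[OF f(1)]) auto
    moreover have "(f u - f z) / (u - z) = \<phi> z" for z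
      unfolding \<phi>_def by (metis minus_diff_eq minus_divide_divide)
    ultimately show ?thesis by simp
  qed simp
  have \<phi>nonneg: "0 \<le> \<phi> x" if "x \<in> {u..v}" "u < x" for x
    using that monotone_onD[OF f(2), of u x] by (auto simp: \<phi>_def)
  have \<psi>mono: "\<psi> x \<le> \<psi> y" if "x \<in> {u..v}" "y \<in> {u..v}" "y < v" "x \<le> y" for x y
  proof (cases "x = y")
    case False
    then show ?thesis
      using that uv convex_on_slope_le(2)[OF f(1), of x v y] by (auto simp: \<psi>_def)
  qed simp
  define r where "r = Inf (\<phi> ` ({u<..} \<inter> {u..v}))"
  define q where "q = Sup (\<psi> ` ({..<v} \<inter> {u..v}))"
  \<comment> \<open>The limit of a monotone function is obtained within the interval; near
    \<open>u\<close> this is the same filter as the right-sided one. The same holds at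
    \<open>v\<close> from the left.\<close>
  have "at u within ({u<..} \<inter> {u..v}) = at_right u"
    using uv by (intro at_within_nhd[of u "{..<v}"]) auto
  then have limr: "(\<phi> \<longlongrightarrow> r) (at_right u)"
    using Lim_right_bound[of "{u..v}" u \<phi> 0] \<phi>mono \<phi>nonneg unfolding r_def by simp
  have "at v within ({..<v} \<inter> {u..v}) = at_left v"
    using uv by (intro at_within_nhd[of v "{u<..}"]) auto
  then have limq: "(\<psi> \<longlongrightarrow> q) (at_left v)"
    using Lim_left_bound[of "{u..v}" v \<psi> \<infinity>] \<psi>mono unfolding q_def by simp
  have slopes: "has_end_slopes f u v (ereal r) q"
    using limr limq unfolding has_end_slopes_def \<phi>_def \<psi>_def by (simp add: tendsto_ereal)
  have r: "r \<le> \<phi> x" if "x \<in> {u..v}" "u < x" for x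
    unfolding r_def using that \<phi>nonneg by (intro cInf_lower) (auto intro!: bdd_belowI2[of _ 0])
  have r0: "0 \<le> r"
    unfolding r_def using uv \<phi>nonneg by (intro cInf_greatest) auto
  have rd: "r \<le> d" using r[of v] uv by (simp add: \<phi>_def d_def)
  have q: "\<psi> x \<le> q" if "x \<in> {u..v}" "x < v" for x
    unfolding q_def using that by (intro Sup_upper) auto
  have "\<psi> u = ereal d"
    unfolding \<psi>_def d_def by (metis minus_diff_eq minus_divide_divide)
  then have qd: "ereal d \<le> q" using q[of u] uv by simp
  define \<sigma> where "\<sigma> = (if q = \<infinity> then 0 else 1 / real_of_ereal q)"
  \<comment> \<open>The bound \<open>ereal d \<le> q\<close> excludes
    \<open>q = -\<infinity>\<close>.\<close>
  have qcases: "q = \<infinity> \<and> \<sigma> = 0 \<or> (\<exists>s. q = ereal s \<and> d \<le> s \<and> \<sigma> = 1 / s)"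
    using qd by (cases q) (auto simp: \<sigma>_def)
  have \<sigma>0: "0 \<le> \<sigma>" "\<sigma> * d \<le> 1" using qcases d by auto
  have "ratio (min \<bar>ereal r\<bar> \<bar>q\<bar>) \<bar>ereal d\<bar> = ereal (r / d)"
    using qcases r0 rd d by (auto simp: ratio_def)
  moreover have "ratio \<bar>ereal d\<bar> (max \<bar>ereal r\<bar> \<bar>q\<bar>) = ereal (d * \<sigma>)"
    using qcases r0 rd d by (auto simp: ratio_def)
  ultimately have index: "linear_index f u v = 1 - (r / d + d * \<sigma>) / 2"
    unfolding linear_index_eq[OF slopes] d_def[symmetric] using d by simp
  have low: "f u + r * (x - u) \<le> f x" if "x \<in> {u..v}" for x
  proof (cases "x = u")
    case False
    then show ?thesis using that r[of x] by (auto simp: \<phi>_def field_simps)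
  qed simp
  have up: "\<sigma> * (f v - f x) \<le> v - x" if "x \<in> {u..v}" for x
    using qcases
  proof
    assume "\<exists>s. q = ereal s \<and> d \<le> s \<and> \<sigma> = 1 / s"
    then obtain s where s: "q = ereal s" "d \<le> s" "\<sigma> = 1 / s" by blast
    show ?thesis
    proof (cases "x = v")
      case False
      have "(f v - f x) / (v - x) = (f x - f v) / (x - v)"
        by (metis minus_diff_eq minus_divide_divide)
      also have "\<dots> \<le> s" using q[of x] that False s by (auto simp: \<psi>_def)
      finally have "f v - f x \<le> s * (v - x)" using that False by (simp add: pos_divide_le_eq)
      then show ?thesis using s d by (simp add: pos_divide_le_eq mult.commute)
    qed simp
  qed (use that in auto)
  show thesis by (rule that[OF slopes index r0 rd \<sigma>0 low up])
qed

text \<open>\<open>T\<close> is the set of interior breakpoints of \<open>g\<close>.\<close>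

definition spline_approx_by ::
  "(real \<Rightarrow> real) \<Rightarrow> real \<Rightarrow> real \<Rightarrow> nat \<Rightarrow> real set \<Rightarrow> real \<Rightarrow> (real \<Rightarrow> real) \<Rightarrow> real set \<Rightarrow> bool" where
  "spline_approx_by f u v N S e g T \<longleftrightarrow>
     g u = f u \<and> g v = f v \<and> continuous_on {u..v} g \<and>
     monotone_or_antitone_on {u..v} g \<and> convex_concave_on {u..v} g \<and>
     finite T \<and> T \<subseteq> {u<..<v} \<and> card T < N \<and>
     (\<forall>c d. u \<le> c \<longrightarrow> c < d \<longrightarrow> d \<le> v \<longrightarrow> {c<..<d} \<inter> T = {} \<longrightarrow> affine_fun_on {c..d} g) \<and>
     (\<Sum>x\<in>S. \<bar>f x - g x\<bar>) \<le> e"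

definition spline_approx ::
  "(real \<Rightarrow> real) \<Rightarrow> real \<Rightarrow> real \<Rightarrow> nat \<Rightarrow> real set \<Rightarrow> real \<Rightarrow> bool" where
  "spline_approx f u v N S e \<longleftrightarrow> (\<exists>g T. spline_approx_by f u v N S e g T)"

section \<open>Reflections of spline approximations in the two axes\<close>

lemma spline_approx_uminus:
  assumes "spline_approx (\<lambda>x. - f x) u v N S e"
  shows "spline_approx f u v N S e"
proof -
  obtain g T where g: "g u = - f u" "g v = - f v" "continuous_on {u..v} g"
    "monotone_or_antitone_on {u..v} g" "convex_concave_on {u..v} g"
    "finite T" "T \<subseteq> {u<..<v}" "card T < N"
    "\<And>c d. u \<le> c \<Longrightarrow> c < d \<Longrightarrow> d \<le> v \<Longrightarrow> {c<..<d} \<inter> T = {} \<Longrightarrow> affine_fun_on {c..d} g"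
    "(\<Sum>x\<in>S. \<bar>- f x - g x\<bar>) \<le> e"
    using assms unfolding spline_approx_def spline_approx_by_def by blast
  have "monotone_or_antitone_on {u..v} (\<lambda>x. - g x)"
    using g(4) by (auto simp: monotone_or_antitone_on_def monotone_on_def)
  moreover have "convex_concave_on {u..v} (\<lambda>x. - g x)"
    using g(5) by (auto simp: convex_concave_on_def concave_on_def)
  moreover have "affine_fun_on {c..d} (\<lambda>x. - g x)" if "affine_fun_on {c..d} g" for c d
  proof -
    obtain a b where "\<forall>x\<in>{c..d}. g x = a * x + b" using \<open>affine_fun_on _ _\<close> unfolding affine_fun_on_def by blast
    then have "\<forall>x\<in>{c..d}. - g x = (- a) * x + (- b)" by auto
    then show ?thesis unfolding affine_fun_on_def by blast
  qed
  moreover have "(\<Sum>x\<in>S. \<bar>f x - - g x\<bar>) \<le> e"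
  proof -
    have "\<bar>f x - - g x\<bar> = \<bar>- f x - g x\<bar>" for x by linarith
    then show ?thesis using g(10) by simp
  qed
  moreover have "continuous_on {u..v} (\<lambda>x. - g x)" using g(3) by (rule continuous_on_minus)
  ultimately show ?thesis
    unfolding spline_approx_def spline_approx_by_def using g by (intro exI[of _ "\<lambda>x. - g x"] exI[of _ T]) auto
qed

lemma convex_on_reflect:
  fixes f :: "real \<Rightarrow> real"
  assumes "convex_on {u..v} f"
  shows "convex_on {- v..- u} (\<lambda>x. f (- x))"
proof (rule convex_onI)
  fix t x y :: real assume "0 < t" "t < 1" "x \<in> {- v..- u}" "y \<in> {- v..- u}"
  then show "f (- ((1 - t) *\<^sub>R x + t *\<^sub>R y)) \<le> (1 - t) * f (- x) + t * f (- y)"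
    using convex_onD[OF assms, of t "- x" "- y"] by (auto simp: algebra_simps)
qed simp

lemma convex_concave_on_reflect:
  fixes f :: "real \<Rightarrow> real"
  assumes "convex_concave_on {u..v} f"
  shows "convex_concave_on {- v..- u} (\<lambda>x. f (- x))"
  using assms convex_on_reflect[of u v f] convex_on_reflect[of u v "\<lambda>x. - f x"]
  by (auto simp: convex_concave_on_def concave_on_def)

lemma spline_approx_reflect:
  assumes "spline_approx (\<lambda>x. f (- x)) (- v) (- u) N (uminus ` S) e"
  shows "spline_approx f u v N S e"
proof -
  obtain g T where g: "g (- v) = f v" "g (- u) = f u" "continuous_on {- v..- u} g"
    "monotone_or_antitone_on {- v..- u} g" "convex_concave_on {- v..- u} g"
    "finite T" "T \<subseteq> {- v<..<- u}" "card T < N"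
    "\<And>c d. - v \<le> c \<Longrightarrow> c < d \<Longrightarrow> d \<le> - u \<Longrightarrow> {c<..<d} \<inter> T = {} \<Longrightarrow> affine_fun_on {c..d} g"
    "(\<Sum>x\<in>uminus ` S. \<bar>f (- x) - g x\<bar>) \<le> e"
    using assms unfolding spline_approx_def spline_approx_by_def by auto
  have "monotone_or_antitone_on {u..v} (\<lambda>x. g (- x))"
    using g(4) unfolding monotone_or_antitone_on_def
  proof
    assume "mono_on {- v..- u} g"
    then have "antimono_on {u..v} (\<lambda>x. g (- x))"
      by (auto simp: monotone_on_def)
    then show "mono_on {u..v} (\<lambda>x. g (- x)) \<or> antimono_on {u..v} (\<lambda>x. g (- x))" ..
  next
    assume "antimono_on {- v..- u} g"
    then have "mono_on {u..v} (\<lambda>x. g (- x))"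
      by (auto simp: monotone_on_def)
    then show "mono_on {u..v} (\<lambda>x. g (- x)) \<or> antimono_on {u..v} (\<lambda>x. g (- x))" ..
  qed
  moreover have "convex_concave_on {u..v} (\<lambda>x. g (- x))"
    using convex_concave_on_reflect[OF g(5)] by simp
  moreover have "affine_fun_on {c..d} (\<lambda>x. g (- x))"
    if "u \<le> c" "c < d" "d \<le> v" "{c<..<d} \<inter> uminus ` T = {}" for c d
  proof -
    have "{- d<..<- c} \<inter> T = {}"
    proof (rule equals0I)
      fix t assume "t \<in> {- d<..<- c} \<inter> T"
      then have "- t \<in> {c<..<d} \<inter> uminus ` T" by auto
      then show False using that(4) by blast
    qed
    then have "affine_fun_on {- d..- c} g" using that by (intro g(9)) auto
    then obtain a b where "\<forall>x\<in>{- d..- c}. g x = a * x + b" unfolding affine_fun_on_def by blast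
    then have "\<forall>x\<in>{c..d}. g (- x) = (- a) * x + b" by auto
    then show ?thesis unfolding affine_fun_on_def by blast
  qed
  moreover have "(\<Sum>x\<in>S. \<bar>f x - g (- x)\<bar>) \<le> e"
    using g(10) by (simp add: sum.reindex)
  moreover have "continuous_on {u..v} (\<lambda>x. g (- x))"
    by (rule continuous_on_compose2[OF g(3)]) (auto intro: continuous_intros)
  moreover have "card (uminus ` T) < N" using g(8) by (simp add: card_image)
  moreover have "uminus ` T \<subseteq> {u<..<v}" using g(7) by force
  ultimately show ?thesis
    unfolding spline_approx_def spline_approx_by_def using g
    by (intro exI[of _ "\<lambda>x. g (- x)"] exI[of _ "uminus ` T"]) auto
qed

section \<open>Approximation of a single convex or concave piece\<close>

text \<open>Closed steps share their end points, so the sets need not be disjoint; nonnegativity of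
  \<open>h\<close> makes repeated points harmless.\<close>

lemma sum_UN_le:
  fixes h :: "'a \<Rightarrow> real"
  assumes "finite I" "\<And>i. i \<in> I \<Longrightarrow> finite (A i)" "\<And>x. 0 \<le> h x"
  shows "sum h (\<Union>i\<in>I. A i) \<le> (\<Sum>i\<in>I. sum h (A i))"
  using assms(1,2)
proof (induction rule: finite_induct)
  case (insert i I)
  have "sum h (A i \<union> (\<Union>i\<in>I. A i)) \<le> sum h (A i) + sum h (\<Union>i\<in>I. A i)"
    using insert sum.union_inter[of "A i" "\<Union>i\<in>I. A i" h] assms(3)
      sum_nonneg[of "A i \<inter> (\<Union>i\<in>I. A i)" h] by (simp add: UN_Un)
  then show ?case using insert by fastforce
qed simp

text \<open>On each step the gap is nonnegative and at most the rise of \<open>f\<close>, so the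
  design points there contribute at most \<open>E i / \<delta>\<close> plus that rise. The rises
  telescope to \<open>f v - f u\<close>.\<close>

lemma spline_approx_of_gaps:
  assumes uv: "u < v" and f: "convex_on {u..v} f" "mono_on {u..v} f"
    and t: "mono_on {..N} t" "t 0 = u" "t N = v"
    and S: "finite S" "S \<subseteq> {u..v}" "separated \<delta> S" "0 < \<delta>"
    and E: "\<And>i. i < N \<Longrightarrow> chord_gap_bounded f (t i) (t (Suc i)) (E i)"
  shows "spline_approx f u v N S ((\<Sum>i<N. E i) / \<delta> + (f v - f u))"
proof -
  obtain g where g: "convex_on {u..v} g" "mono_on {u..v} g" "continuous_on {u..v} g"
    and chord: "\<And>i x. i < N \<Longrightarrow> t i < t (Suc i) \<Longrightarrow> x \<in> {t i..t (Suc i)} \<Longrightarrow>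
      g x = chord f (t i) (t (Suc i)) x"
    using convex_interpolation[OF f t uv] by blast
  have tin: "t i \<in> {u..v}" if "i \<le> N" for i
    using that monotone_onD[OF t(1), of 0 i] monotone_onD[OF t(1), of i N] t(2,3) by auto
  have tle: "t i \<le> t j" if "i \<le> j" "j \<le> N" for i j
    using that monotone_onD[OF t(1), of i j] by auto
  have step: "\<exists>i<N. t i < t (Suc i) \<and> x \<in> {t i..t (Suc i)}" if "x \<in> {u..v}" for x
    using exists_nonzero_step_containing[of t x N] that t uv by auto
  have gu: "g u = f u"
  proof -
    obtain i where i: "i < N" "t i < t (Suc i)" "u \<in> {t i..t (Suc i)}" using step[of u] uv by auto
    then have "u = t i" using tin[of i] by auto
    then show ?thesis using chord[OF i] by simp
  qed
  have gv: "g v = f v"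
  proof -
    obtain i where i: "i < N" "t i < t (Suc i)" "v \<in> {t i..t (Suc i)}" using step[of v] uv by auto
    then have "v = t (Suc i)" using tin[of "Suc i"] by auto
    then show ?thesis using chord[OF i] i by simp
  qed
  define T where "T = t ` {..N} \<inter> {u<..<v}"
  \<comment> \<open>The first and the last breakpoint are the ends of the interval, which leaves at
    most \<open>N - 1\<close> interior ones.\<close>
  have "T \<subseteq> t ` {1..<N}"
  proof
    fix x assume "x \<in> T"
    then obtain i where i: "i \<le> N" "x = t i" "x \<noteq> u" "x \<noteq> v" by (auto simp: T_def)
    then have "i \<noteq> 0" "i \<noteq> N" using t by metis+
    then show "x \<in> t ` {1..<N}" using i by auto
  qed
  then have "card T \<le> card {1..<N}" by (metis card_image_le card_mono finite_atLeastLessThan finite_imageI le_trans)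
  moreover have "N \<noteq> 0" using t uv by (cases N) auto
  ultimately have T: "card T < N" by simp
  have affine: "affine_fun_on {c..d} g"
    if cd: "u \<le> c" "c < d" "d \<le> v" "{c<..<d} \<inter> T = {}" for c d
  proof -
    \<comment> \<open>The step containing the midpoint of \<open>{c..d}\<close> contains the whole
      interval, because no breakpoint lies strictly between \<open>c\<close> and
      \<open>d\<close>.\<close>
    obtain i where i: "i < N" "t i < t (Suc i)" "(c + d) / 2 \<in> {t i..t (Suc i)}"
      using step[of "(c + d) / 2"] cd by auto
    have out: "t j \<notin> {c<..<d}" if "j \<le> N" for j
      using cd that by (auto simp: T_def disjoint_iff)
    have "t i \<le> c" using out[of i] i cd by (auto simp: field_simps)
    moreover have "d \<le> t (Suc i)" using out[of "Suc i"] i cd by (auto simp: field_simps)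
    ultimately have "\<forall>x\<in>{c..d}. g x = (f (t (Suc i)) - f (t i)) / (t (Suc i) - t i) * x
        + (f (t i) - (f (t (Suc i)) - f (t i)) / (t (Suc i) - t i) * t i)"
      using chord[OF i(1,2)] by (auto simp: chord_def right_diff_distrib)
    then show ?thesis unfolding affine_fun_on_def by blast
  qed
  \<comment> \<open>Steps of zero length are given no design points; every point is still covered by
    some step of positive length.\<close>
  define A where "A i = (if t i < t (Suc i) then S \<inter> {t i..t (Suc i)} else {})" for i
  have err: "(\<Sum>x\<in>A i. \<bar>f x - g x\<bar>) \<le> E i / \<delta> + (f (t (Suc i)) - f (t i))" if "i < N" for i
  proof (cases "t i < t (Suc i)")
    case True
    have sub: "x \<in> {u..v}" if "x \<in> {t i..t (Suc i)}" for x
      using that tin[of i] tin[of "Suc i"] \<open>i < N\<close> by auto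
    have ge: "f x \<le> g x" if "x \<in> {t i..t (Suc i)}" for x
      using chord[OF \<open>i < N\<close> True that] that True tin[of i] tin[of "Suc i"] \<open>i < N\<close>
        convex_on_le_chord[OF f(1), of "t i" "t (Suc i)" x] by auto
    have "g x - f x \<le> f (t (Suc i)) - f (t i)" if "x \<in> {t i..t (Suc i)}" for x
    proof -
      have "f (t i) \<le> f x"
        using that sub[OF that] tin[of i] \<open>i < N\<close> by (intro monotone_onD[OF f(2)]) auto
      moreover have "g x \<le> g (t (Suc i))"
        using that sub[OF that] tin[of "Suc i"] \<open>i < N\<close> by (intro monotone_onD[OF g(2)]) auto
      moreover have "g (t (Suc i)) = f (t (Suc i))" using chord[OF \<open>i < N\<close> True] True by simp
      ultimately show ?thesis by linarith
    qed
    moreover have "(t (Suc i) - t i) * (g x - f x) \<le> E i" if "x \<in> {t i..t (Suc i)}" for x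
      using E[OF \<open>i < N\<close>] True that chord[OF \<open>i < N\<close> True that] by (auto simp: chord_gap_bounded_def)
    moreover have "\<bar>f x - g x\<bar> = g x - f x" if "x \<in> {t i..t (Suc i)}" for x
      using ge[OF that] by simp
    ultimately have "(\<Sum>x\<in>S \<inter> {t i..t (Suc i)}. \<bar>f x - g x\<bar>) \<le> E i / \<delta> + (f (t (Suc i)) - f (t i))"
      using True S ge by (intro sum_separated_Icc_le) auto
    then show ?thesis using True by (simp add: A_def)
  next
    case False
    then have "0 \<le> f (t (Suc i)) - f (t i)"
      using tle[of i "Suc i"] that tin by (simp add: antisym)
    moreover have "0 \<le> E i / \<delta>" using E[OF that] S by (simp add: chord_gap_bounded_def)
    ultimately show ?thesis using False by (simp add: A_def)
  qed
  have "S \<subseteq> (\<Union>i<N. A i)"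
  proof
    fix x assume "x \<in> S"
    then show "x \<in> (\<Union>i<N. A i)" using step[of x] S by (force simp: A_def)
  qed
  then have "(\<Sum>x\<in>S. \<bar>f x - g x\<bar>) \<le> (\<Sum>x\<in>(\<Union>i<N. A i). \<bar>f x - g x\<bar>)"
    using S by (intro sum_mono2) (auto simp: A_def)
  also have "\<dots> \<le> (\<Sum>i<N. \<Sum>x\<in>A i. \<bar>f x - g x\<bar>)"
    using S by (intro sum_UN_le) (auto simp: A_def)
  also have "\<dots> \<le> (\<Sum>i<N. E i / \<delta> + (f (t (Suc i)) - f (t i)))" using err by (intro sum_mono) auto
  also have "\<dots> = (\<Sum>i<N. E i) / \<delta> + (f v - f u)"
    by (simp add: sum.distrib sum_lessThan_telescope[of "\<lambda>i. f (t i)"] t flip: sum_divide_distrib)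
  finally have "(\<Sum>x\<in>S. \<bar>f x - g x\<bar>) \<le> (\<Sum>i<N. E i) / \<delta> + (f v - f u)" .
  moreover have "finite T" "T \<subseteq> {u<..<v}" by (auto simp: T_def)
  ultimately show ?thesis
    unfolding spline_approx_def spline_approx_by_def monotone_or_antitone_on_def convex_concave_on_def
    using g gu gv T affine by (intro exI[of _ g] exI[of _ T]) auto
qed

text \<open>The interval is cut at a point \<open>w\<close> where the slope passes through the mean slope \<open>d\<close>:
  to the left of \<open>w\<close> equal steps are taken on the horizontal axis, to the right of it on the
  vertical axis.\<close>

lemma spline_approx_convex_mono:
  fixes f :: "real \<Rightarrow> real"
  assumes uv: "u < v" and cont: "continuous_on {u..v} f"
    and f: "convex_on {u..v} f" "mono_on {u..v} f" "f u < f v" and D: "0 < D"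
    and S: "finite S" "S \<subseteq> {u..v}" "separated \<delta> S" "0 < \<delta>"
      "v - u \<le> (real (card S) + 1) * \<delta>"
  shows "0 \<le> linear_index f u v \<and> (\<exists>p q. has_end_slopes f u v p q) \<and>
    spline_approx f u v (2 * D) S
      (real (card S) * (f v - f u) * linear_index f u v / (real D)\<^sup>2 + 2 * (f v - f u))"
proof -
  define d V \<Gamma> where "d = (f v - f u) / (v - u)" "V = f v - f u" "\<Gamma> = linear_index f u v"
  note defs = this
  have V: "0 < V" "d * (v - u) = V" "0 < d" using uv f by (auto simp: defs)
  obtain p q r \<sigma> where slopes: "has_end_slopes f u v p q"
    and \<Gamma>: "\<Gamma> = 1 - (r / d + d * \<sigma>) / 2"
    and r: "0 \<le> r" "r \<le> d" "\<And>x. x \<in> {u..v} \<Longrightarrow> f u + r * (x - u) \<le> f x"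
    and \<sigma>: "0 \<le> \<sigma>" "\<sigma> * d \<le> 1" "\<And>x. x \<in> {u..v} \<Longrightarrow> \<sigma> * (f v - f x) \<le> v - x"
    using convex_mono_end_slopes[OF uv f] unfolding defs by metis
  have "0 \<le> r / d" "r / d \<le> 1" "0 \<le> \<sigma> * d" using r \<sigma> V by simp_all
  with \<sigma>(2) have "0 \<le> r / d + d * \<sigma>" "r / d + d * \<sigma> \<le> 2"
    unfolding mult.commute[of d] by (auto intro: add_mono[of _ 1 _ 1, simplified])
  then have \<Gamma>01: "0 \<le> \<Gamma>" "\<Gamma> \<le> 1" unfolding \<Gamma> by simp_all
  \<comment> \<open>A minimiser \<open>w\<close> of \<open>f x - d * x\<close> is a point where the
    line of slope \<open>d\<close> supports the graph, whether or not \<open>f\<close> is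
    differentiable there.\<close>
  have "continuous_on {u..v} (\<lambda>x. f x - d * x)" using cont by (intro continuous_intros)
  then obtain w where w: "w \<in> {u..v}" "\<And>x. x \<in> {u..v} \<Longrightarrow> f w - d * w \<le> f x - d * x"
    using continuous_attains_inf[of "{u..v}" "\<lambda>x. f x - d * x"] uv by auto
  have dw: "f w + d * (x - w) \<le> f x" if "x \<in> {u..v}" for x
    using w(2)[OF that] by (simp add: algebra_simps)
  have fw: "f u \<le> f w" "f w \<le> f v" using w uv by (auto intro!: monotone_onD[OF f(2)])
  have "\<exists>y. (j = 0 \<longrightarrow> y = w) \<and> (j = D \<longrightarrow> y = v) \<and>
      (j \<le> D \<longrightarrow> y \<in> {w..v} \<and> f y = f w + (f v - f w) * (real j / real D))" for j
  proof -
    consider "j = 0" | "j = D" | "0 < j" "j < D" | "D < j" by linarith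
    then show ?thesis
    proof cases
      case 3
      have "(f v - f w) * (real j / real D) \<le> (f v - f w) * 1"
        using 3 fw by (intro mult_left_mono) auto
      moreover have "0 \<le> (f v - f w) * (real j / real D)" using fw by simp
      ultimately obtain y where "w \<le> y" "y \<le> v" "f y = f w + (f v - f w) * (real j / real D)"
        using IVT'[of f w "f w + (f v - f w) * (real j / real D)" v] w
          continuous_on_subset[OF cont, of "{w..v}"] by auto
      then show ?thesis using 3 by auto
    qed (use D w in auto)
  qed
  then obtain t2 where t2: "t2 0 = w" "t2 D = v"
    "\<And>j. j \<le> D \<Longrightarrow> t2 j \<in> {w..v}" "\<And>j. j \<le> D \<Longrightarrow> f (t2 j) = f w + (f v - f w) * (real j / real D)"
    by metis
  define t1 where "t1 i = u + (w - u) * (real i / real D)" for i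
  have t1: "t1 0 = u" "t1 D = w" "mono t1"
    using D w by (auto simp: t1_def intro!: monoI mult_left_mono divide_right_mono)
  \<comment> \<open>To the left of \<open>w\<close> the slopes run from \<open>r\<close> to
    \<open>d\<close>; to its right, below, the inverse slopes run from \<open>1 / d\<close> to
    \<open>\<sigma>\<close>.\<close>
  obtain E1 where E1: "\<And>i. i < D \<Longrightarrow> chord_gap_bounded f (t1 i) (t1 (Suc i)) (E1 i)"
    "(\<Sum>i<D. E1 i) = (w - u)\<^sup>2 * (d - r) / (4 * (real D)\<^sup>2)"
    using equal_steps_gap[OF f(1) _ _ D r(3) dw, of t1] w t1_def by auto
  obtain E2 where E2: "mono_on {..D} t2"
    "\<And>i. i < D \<Longrightarrow> chord_gap_bounded f (t2 i) (t2 (Suc i)) (E2 i)"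
    "(\<Sum>i<D. E2 i) = (f v - f w)\<^sup>2 * (1 / d - \<sigma>) / (4 * (real D)\<^sup>2)"
    using equal_levels_gap[OF f(1,2) _ _ D V(3) dw \<sigma>(3) t2(3,1,2,4)] w by auto
  define t where "t i = (if i \<le> D then t1 i else t2 (i - D))" for i
  define E where "E i = (if i < D then E1 i else E2 (i - D))" for i
  \<comment> \<open>The two sequences of breakpoints agree at index \<open>D\<close>, where both
    equal \<open>w\<close>.\<close>
  have t_high: "t (D + j) = t2 j" for j using t1 t2 by (cases j) (auto simp: t_def)
  have "mono_on {..2 * D} t"
  proof (rule mono_onI)
    fix i j assume ij: "i \<in> {..2 * D}" "j \<in> {..2 * D}" "i \<le> j"
    consider "j \<le> D" | "D \<le> i" | "i \<le> D" "D \<le> j" by linarith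
    then show "t i \<le> t j"
    proof cases
      case 1
      then show ?thesis using ij monoD[OF t1(3)] by (simp add: t_def)
    next
      case 2
      then show ?thesis
        using ij t_high[of "i - D"] t_high[of "j - D"] monotone_onD[OF E2(1), of "i - D" "j - D"] by auto
    next
      case 3
      have "t i \<le> w" using 3 monoD[OF t1(3), of i D] t1 by (simp add: t_def)
      moreover have "w \<le> t j" using ij 3 t_high[of "j - D"] t2(3)[of "j - D"] by auto
      ultimately show ?thesis by simp
    qed
  qed
  moreover have "t 0 = u" "t (2 * D) = v"
    using t1 t2 t_high[of D] by (auto simp: t_def mult_2)
  moreover have "chord_gap_bounded f (t i) (t (Suc i)) (E i)" if "i < 2 * D" for i
  proof (cases "i < D")
    case True
    then show ?thesis using E1(1)[of i] by (simp add: t_def E_def)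
  next
    case False
    then show ?thesis
      using that E2(2)[of "i - D"] t_high[of "i - D"] t_high[of "Suc (i - D)"]
      by (simp add: E_def Suc_diff_le)
  qed
  ultimately have approx: "spline_approx f u v (2 * D) S ((\<Sum>i<2 * D. E i) / \<delta> + V)"
    unfolding defs by (intro spline_approx_of_gaps[where t = t] uv f S) auto
  have "(\<Sum>i<2 * D. E i) = (\<Sum>i<D. E1 i) + (\<Sum>i<D. E2 i)"
  proof -
    have "(\<Sum>i<D + k. E i) = (\<Sum>i<D. E1 i) + (\<Sum>i<k. E2 i)" for k
      by (induction k) (simp_all add: E_def)
    from this[of D] show ?thesis by (simp add: mult_2)
  qed
  \<comment> \<open>Enlarge \<open>w - u\<close> to \<open>v - u\<close> and
    \<open>f v - f w\<close> to \<open>V\<close>. Since \<open>V = d * (v - u)\<close>, both sums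
    then carry the factor \<open>(v - u) * V\<close>, and
    \<open>(1 - r / d) + (1 - d * \<sigma>) = 2 * \<Gamma>\<close>.\<close>
  also have "\<dots> \<le> (v - u) * V * \<Gamma> / (2 * (real D)\<^sup>2)"
  proof -
    have "(w - u)\<^sup>2 * (d - r) \<le> (v - u)\<^sup>2 * (d - r)"
      using w uv r by (intro mult_right_mono power_mono) auto
    also have "\<dots> = (v - u) * (d * (v - u)) * (1 - r / d)"
      using V(3) by (simp add: power2_eq_square field_simps)
    also note V(2)
    finally have a: "(w - u)\<^sup>2 * (d - r) \<le> (v - u) * V * (1 - r / d)" .
    have "\<sigma> \<le> 1 / d" using \<sigma> V by (simp add: field_simps)
    then have "(f v - f w)\<^sup>2 * (1 / d - \<sigma>) \<le> V\<^sup>2 * (1 / d - \<sigma>)"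
      using fw unfolding defs by (intro mult_right_mono power_mono) auto
    also have "\<dots> = V / d * V * (1 - d * \<sigma>)"
      using V(3) by (simp add: power2_eq_square field_simps)
    also have "V / d = v - u" using V(2,3) by (simp add: field_simps)
    finally have b: "(f v - f w)\<^sup>2 * (1 / d - \<sigma>) \<le> (v - u) * V * (1 - d * \<sigma>)" .
    have "(\<Sum>i<D. E1 i) + (\<Sum>i<D. E2 i) \<le>
        ((v - u) * V * (1 - r / d) + (v - u) * V * (1 - d * \<sigma>)) / (4 * (real D)\<^sup>2)"
      unfolding E1 E2 add_divide_distrib[symmetric] using a b by (intro divide_right_mono) auto
    also have "(v - u) * V * (1 - r / d) + (v - u) * V * (1 - d * \<sigma>) = 2 * ((v - u) * V * \<Gamma>)"
    proof -
      have "M * (1 - \<alpha>) + M * (1 - \<beta>) = 2 * (M * (1 - (\<alpha> + \<beta>) / 2))" for M \<alpha> \<beta> :: real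
        by (simp add: field_simps)
      then show ?thesis unfolding \<Gamma> .
    qed
    also have "2 * ((v - u) * V * \<Gamma>) / (4 * (real D)\<^sup>2) = (v - u) * V * \<Gamma> / (2 * (real D)\<^sup>2)"
      using mult_divide_mult_cancel_left[of 2 "(v - u) * V * \<Gamma>" "2 * (real D)\<^sup>2"] by (simp del: mult_divide_mult_cancel_left)
    finally show ?thesis .
  qed
  finally have "(\<Sum>i<2 * D. E i) / \<delta> \<le> (v - u) * V * \<Gamma> / (2 * (real D)\<^sup>2) / \<delta>"
    using S by (intro divide_right_mono) auto
  also have "\<dots> = ((v - u) / \<delta>) * (V * \<Gamma> / (2 * (real D)\<^sup>2))" by (simp add: mult.commute mult.left_commute)
  \<comment> \<open>The count of points may fall one spacing short of the length. The surplus is at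
    most \<open>V\<close>, which together with the \<open>V\<close> from the rises gives
    \<open>2 * V\<close>; the factor 2 in the denominator is given up.\<close>
  also have "\<dots> \<le> (real (card S) + 1) * (V * \<Gamma> / (2 * (real D)\<^sup>2))"
    using S V \<Gamma>01 by (intro mult_right_mono) (auto simp: pos_divide_le_eq)
  also have "\<dots> = real (card S) * V * \<Gamma> / (2 * (real D)\<^sup>2) + V * \<Gamma> / (2 * (real D)\<^sup>2)"
    by (simp add: algebra_simps add_divide_distrib)
  also have "\<dots> \<le> real (card S) * V * \<Gamma> / (real D)\<^sup>2 + V"
  proof (rule add_mono)
    show "real (card S) * V * \<Gamma> / (2 * (real D)\<^sup>2) \<le> real (card S) * V * \<Gamma> / (real D)\<^sup>2"
      using V \<Gamma>01 D by (intro divide_left_mono) auto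
    have "1 \<le> (real D)\<^sup>2" using D by simp
    then have "V * \<Gamma> / (2 * (real D)\<^sup>2) \<le> V * 1 / 1"
      using V \<Gamma>01 by (intro frac_le mult_left_mono) auto
    then show "V * \<Gamma> / (2 * (real D)\<^sup>2) \<le> V" by simp
  qed
  finally have "(\<Sum>i<2 * D. E i) / \<delta> + V \<le> real (card S) * V * \<Gamma> / (real D)\<^sup>2 + 2 * V" by simp
  then have "spline_approx f u v (2 * D) S (real (card S) * V * \<Gamma> / (real D)\<^sup>2 + 2 * V)"
    using approx unfolding spline_approx_def spline_approx_by_def by (meson order_trans)
  then show ?thesis using \<Gamma>01 slopes unfolding defs by blast
qed

text \<open>The four shapes reduce to the convex increasing one by changing the sign of
  \<open>f\<close> or of its argument. The index appears only multiplied by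
  \<open>\<bar>f v - f u\<bar>\<close>, so for constant \<open>f\<close> its value does not
  matter.\<close>

lemma spline_approx_monotone:
  fixes f :: "real \<Rightarrow> real"
  assumes uv: "u < v" and cont: "continuous_on {u..v} f"
    and f: "convex_concave_on {u..v} f" "monotone_or_antitone_on {u..v} f" and D: "0 < D"
    and S: "finite S" "S \<subseteq> {u..v}" "separated \<delta> S" "0 < \<delta>"
      "v - u \<le> (real (card S) + 1) * \<delta>"
  shows "0 \<le> \<bar>f v - f u\<bar> * linear_index f u v \<and>
    spline_approx f u v (2 * D) S
      (real (card S) * \<bar>f v - f u\<bar> * linear_index f u v / (real D)\<^sup>2 + 2 * \<bar>f v - f u\<bar>)"
proof -
  \<comment> \<open>Existence of end slopes is carried along for nonconstant \<open>f\<close>,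
    because the reflection rules for the index rely on it.\<close>
  let ?P = "\<lambda>f u v S. 0 \<le> \<bar>f v - f u\<bar> * linear_index f u v \<and>
    (f u \<noteq> f v \<longrightarrow> (\<exists>p q. has_end_slopes f u v p q)) \<and>
    spline_approx f u v (2 * D) S
      (real (card S) * \<bar>f v - f u\<bar> * linear_index f u v / (real D)\<^sup>2 + 2 * \<bar>f v - f u\<bar>)"
  \<comment> \<open>Equal values at the ends make a monotone function constant, so \<open>f\<close>
    itself serves as spline without interior breakpoints.\<close>
  have const: "?P f u v S" if "u < v" "continuous_on {u..v} f" "convex_concave_on {u..v} f"
    "monotone_or_antitone_on {u..v} f" "f u = f v" "S \<subseteq> {u..v}" for f :: "real \<Rightarrow> real" and u v S
  proof -
    note mono = that(4)
    have eq: "f x = f u" if "x \<in> {u..v}" for x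
    proof -
      have "u \<in> {u..v}" "v \<in> {u..v}" "u \<le> x" "x \<le> v" using that by auto
      then show ?thesis
        using mono \<open>f u = f v\<close> that
        unfolding monotone_or_antitone_on_def monotone_on_def by (metis order_antisym)
    qed
    have "affine_fun_on {c..d} f" if "u \<le> c" "d \<le> v" for c d
    proof -
      have "f x = 0 * x + f u" if "x \<in> {c..d}" for x
        using eq[of x] that \<open>u \<le> c\<close> \<open>d \<le> v\<close> by simp
      then show ?thesis unfolding affine_fun_on_def by blast
    qed
    then have "spline_approx f u v (2 * D) S 0"
      unfolding spline_approx_def spline_approx_by_def using that D by (intro exI[of _ f] exI[of _ "{}"]) auto
    then show ?thesis using that by simp
  qed
  have up: "?P f u v S" if "u < v" "continuous_on {u..v} f" "convex_on {u..v} f" "mono_on {u..v} f"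
    "finite S" "S \<subseteq> {u..v}" "separated \<delta> S" "v - u \<le> (real (card S) + 1) * \<delta>"
    for f :: "real \<Rightarrow> real" and u v S
  proof (cases "f u = f v")
    case True
    then show ?thesis
      using that by (intro const) (auto simp: convex_concave_on_def monotone_or_antitone_on_def)
  next
    case False
    then have "f u < f v" using monotone_onD[OF that(4), of u v] that(1) by auto
    then show ?thesis
      using spline_approx_convex_mono[OF that(1,2,3,4) _ D that(5-7) \<open>0 < \<delta>\<close> that(8)] by auto
  qed
  have neg: "?P f u v S" if P: "?P (\<lambda>x. - f x) u v S" for f :: "real \<Rightarrow> real" and u v S
  proof -
    have abs_eq: "\<bar>- f v - - f u\<bar> = \<bar>f v - f u\<bar>" by simp
    note approx = spline_approx_uminus[OF P[unfolded abs_eq, THEN conjunct2, THEN conjunct2]]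
    show ?thesis
    proof (cases "f u = f v")
      case True
      then show ?thesis using approx by simp
    next
      case False
      then obtain p q where pq: "has_end_slopes (\<lambda>x. - f x) u v p q" using P by auto
      have "linear_index (\<lambda>x. - f x) u v = linear_index f u v"
        using linear_index_uminus[OF pq] by simp
      moreover have "has_end_slopes f u v (- p) (- q)" using has_end_slopes_uminus[OF pq] by simp
      ultimately show ?thesis using approx P[unfolded abs_eq, THEN conjunct1] by auto
    qed
  qed
  have refl: "?P f u v S" if P: "?P (\<lambda>x. f (- x)) (- v) (- u) (uminus ` S)"
    for f :: "real \<Rightarrow> real" and u v S
  proof -
    have abs_eq: "\<bar>f (- (- u)) - f (- (- v))\<bar> = \<bar>f v - f u\<bar>" by simp
    have card_eq: "card (uminus ` S) = card S" by (simp add: card_image)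
    note approx = spline_approx_reflect[OF P[unfolded abs_eq card_eq, THEN conjunct2, THEN conjunct2]]
    show ?thesis
    proof (cases "f u = f v")
      case True
      then show ?thesis using approx by simp
    next
      case False
      then obtain p q where pq: "has_end_slopes (\<lambda>x. f (- x)) (- v) (- u) p q" using P by auto
      have "linear_index (\<lambda>x. f (- x)) (- v) (- u) = linear_index f u v"
        using linear_index_reflect[OF pq] by simp
      moreover have "has_end_slopes f u v (- q) (- p)" using has_end_slopes_reflect[OF pq] by simp
      ultimately show ?thesis using approx P[unfolded abs_eq, THEN conjunct1] by auto
    qed
  qed
  have down: "?P f u v S" if "u < v" "continuous_on {u..v} f" "convex_on {u..v} f" "antimono_on {u..v} f"
    "finite S" "S \<subseteq> {u..v}" "separated \<delta> S" "v - u \<le> (real (card S) + 1) * \<delta>"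
    for f :: "real \<Rightarrow> real" and u v S
  proof (rule refl, rule up)
    show "continuous_on {- v..- u} (\<lambda>x. f (- x))"
      by (rule continuous_on_compose2[OF that(2)]) (auto intro: continuous_intros)
    show "convex_on {- v..- u} (\<lambda>x. f (- x))" using convex_on_reflect[OF that(3)] .
    show "mono_on {- v..- u} (\<lambda>x. f (- x))" using that(4) by (auto simp: monotone_on_def)
    show "separated \<delta> (uminus ` S)" using that(7) by (auto simp: separated_def abs_minus_commute)
    show "- u - - v \<le> (real (card (uminus ` S)) + 1) * \<delta>" using that(8) by (simp add: card_image)
  qed (use that in auto)
  consider "convex_on {u..v} f" "mono_on {u..v} f" | "convex_on {u..v} f" "antimono_on {u..v} f"
    | "concave_on {u..v} f" "mono_on {u..v} f" | "concave_on {u..v} f" "antimono_on {u..v} f"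
    using f unfolding convex_concave_on_def monotone_or_antitone_on_def by blast
  then have "?P f u v S"
  proof cases
    case 1
    then show ?thesis using uv cont S by (intro up) auto
  next
    case 2
    then show ?thesis using uv cont S by (intro down) auto
  next
    case 3
    have "antimono_on {u..v} (\<lambda>x. - f x)" using 3 by (auto simp: monotone_on_def)
    then show ?thesis
      by - (rule neg, rule down,
        use 3 uv cont S in \<open>auto simp: concave_on_def intro: continuous_on_minus\<close>)
  next
    case 4
    have "mono_on {u..v} (\<lambda>x. - f x)" using 4 by (auto simp: monotone_on_def)
    then show ?thesis
      by - (rule neg, rule up,
        use 4 uv cont S in \<open>auto simp: concave_on_def intro: continuous_on_minus\<close>)
  qed
  then show ?thesis by blast
qed

section \<open>Intervals and partitions\<close>

text \<open>Positive measure excludes a single point, so infimum and supremum differ;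
  \<open>J\<close> is then caught between the open and the closed interval with these ends.\<close>

lemma nontrivial_interval_endpoints:
  assumes "nontrivial_interval J" "J \<subseteq> {a..b}"
  shows "Inf J < Sup J" "{Inf J<..<Sup J} \<subseteq> J" "J \<subseteq> {Inf J..Sup J}"
    "closure J = {Inf J..Sup J}"
proof -
  have J: "is_interval J" "0 < emeasure lborel J" using assms by (auto simp: nontrivial_interval_def)
  have ne: "J \<noteq> {}" using J by auto
  have bdd: "bdd_below J" "bdd_above J" using assms(2) by (meson bdd_below_mono bdd_above_mono bdd_below_Icc bdd_above_Icc)+
  show sub: "J \<subseteq> {Inf J..Sup J}" using bdd by (auto intro: cInf_lower cSup_upper)
  have "Inf J \<le> Sup J" using ne bdd by (simp add: cInf_le_cSup)
  moreover have "Inf J \<noteq> Sup J"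
  proof
    assume "Inf J = Sup J"
    then have "J \<subseteq> {Sup J}" using sub by simp
    then have "emeasure lborel J = 0"
      by (metis emeasure_lborel_countable countable_empty countable_insert countable_subset)
    then show False using J by simp
  qed
  ultimately show lt: "Inf J < Sup J" by simp
  show open_sub: "{Inf J<..<Sup J} \<subseteq> J"
  proof
    fix x assume "x \<in> {Inf J<..<Sup J}"
    then obtain y z where "y \<in> J" "y < x" "z \<in> J" "x < z"
      using cInf_lessD[OF ne] less_cSupD[OF ne] by (metis greaterThanLessThan_iff)
    then show "x \<in> J" using J(1) by (meson is_interval_1 less_imp_le)
  qed
  have "closure {Inf J<..<Sup J} = {Inf J..Sup J}" using lt by simp
  then show "closure J = {Inf J..Sup J}"
    using closure_mono[OF open_sub] closure_minimal[OF sub] by auto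
qed

lemma nontrivial_intervalI:
  assumes "is_interval J" "{u<..<v} \<subseteq> J" "u < v"
  shows "nontrivial_interval J"
proof -
  have "J \<in> sets lborel" using assms(1) by (simp add: is_interval_convex_1 real_interval_borel_measurable is_interval_1)
  then have "emeasure lborel {u<..<v} \<le> emeasure lborel J" using assms(2) by (intro emeasure_mono)
  moreover have "0 < emeasure lborel {u<..<v}" using assms(3) by simp
  ultimately show ?thesis using assms(1) unfolding nontrivial_interval_def by (metis order_less_le_trans)
qed

text \<open>\<open>J\<close> may lack its end points, so the extreme values need not be attained on
  it; continuity on the closure still makes them the supremum and infimum over
  \<open>J\<close>.\<close>

lemma variation_on_eq:
  assumes J: "nontrivial_interval J" "J \<subseteq> {a..b}"
    and f: "continuous_on (closure J) f" "monotone_or_antitone_on (closure J) f"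
  shows "variation_on f J = \<bar>f (Sup J) - f (Inf J)\<bar>"
proof -
  note I = nontrivial_interval_endpoints[OF J]
  have ne: "J \<noteq> {}" using I by auto
  have bounds: "(SUP y\<in>J. f y) = M \<and> (INF y\<in>J. f y) = m"
    if "\<And>y. y \<in> J \<Longrightarrow> m \<le> f y \<and> f y \<le> M" "z \<in> closure J" "f z = m" "z' \<in> closure J" "f z' = M"
    for m M z z'
  proof
    show "(SUP y\<in>J. f y) = M"
    proof (rule antisym)
      show "(SUP y\<in>J. f y) \<le> M" using ne that(1) by (intro cSUP_least) auto
      have "f z' \<le> (SUP y\<in>J. f y)"
        using that(1) by (intro continuous_le_on_closure[OF f(1) that(4)] cSUP_upper) (auto intro!: bdd_aboveI2)
      then show "M \<le> (SUP y\<in>J. f y)" using that by simp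
    qed
    show "(INF y\<in>J. f y) = m"
    proof (rule antisym)
      show "m \<le> (INF y\<in>J. f y)" using ne that(1) by (intro cINF_greatest) auto
      have "(INF y\<in>J. f y) \<le> f z"
        using that(1) by (intro continuous_ge_on_closure[OF f(1) that(2)] cINF_lower) (auto intro!: bdd_belowI2)
      then show "(INF y\<in>J. f y) \<le> m" using that by simp
    qed
  qed
  have ends: "Inf J \<in> closure J" "Sup J \<in> closure J" using I by auto
  have sub: "y \<in> closure J \<and> Inf J \<le> y \<and> y \<le> Sup J" if "y \<in> J" for y using that I by auto
  show ?thesis
    using f(2) unfolding monotone_or_antitone_on_def
  proof
    assume "mono_on (closure J) f"
    then have "\<And>y. y \<in> J \<Longrightarrow> f (Inf J) \<le> f y \<and> f y \<le> f (Sup J)" "f (Inf J) \<le> f (Sup J)"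
      using sub ends I(1) by (auto simp: monotone_on_def)
    then show ?thesis
      using bounds[of "f (Inf J)" "f (Sup J)"] ends unfolding variation_on_def by auto
  next
    assume "antimono_on (closure J) f"
    then have "\<And>y. y \<in> J \<Longrightarrow> f (Sup J) \<le> f y \<and> f y \<le> f (Inf J)" "f (Sup J) \<le> f (Inf J)"
      using sub ends I(1) by (auto simp: monotone_on_def)
    then show ?thesis
      using bounds[of "f (Sup J)" "f (Inf J)"] ends unfolding variation_on_def by auto
  qed
qed

text \<open>Induction on the largest cut point \<open>z\<close>: the part of \<open>J\<close> from
  \<open>z\<close> on has no cut in its interior, and the part before \<open>z\<close> is split by
  the induction hypothesis. The cut point goes to the right-hand piece.\<close>

lemma nontrivial_interval_split:
  assumes J: "is_interval J" "{u<..<v} \<subseteq> J" "J \<subseteq> {u..v}" "u < v"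
    and T: "finite T" "T \<subseteq> {u<..<v}"
  shows "\<exists>Q. interval_partition (card T + 1) J Q \<and>
    (\<forall>I\<in>Q. \<exists>c d. u \<le> c \<and> c < d \<and> d \<le> v \<and> I \<subseteq> {c..d} \<and> {c<..<d} \<inter> T = {})"
  using T(1) J T(2)
proof (induction T arbitrary: J v rule: finite_linorder_max_induct)
  case empty
  have "J \<noteq> {}" using empty by force
  then have "interval_partition 1 J {J}"
    using empty nontrivial_intervalI[of J u v] by (auto simp: interval_partition_def partition_on_space)
  then show ?case using empty by (intro exI[of _ "{J}"]) auto
next
  case (insert z T)
  have z: "u < z" "z < v" using insert.prems by auto
  let ?L = "J \<inter> {..<z}" and ?R = "J \<inter> {z..}"
  have "\<exists>Q. interval_partition (card T + 1) ?L Q \<and>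
    (\<forall>I\<in>Q. \<exists>c d. u \<le> c \<and> c < d \<and> d \<le> z \<and> I \<subseteq> {c..d} \<and> {c<..<d} \<inter> T = {})"
  proof (rule insert.IH)
    show "is_interval ?L" using insert.prems(1) by (auto simp: is_interval_1)
    show "{u<..<z} \<subseteq> ?L" using insert.prems z by force
    show "?L \<subseteq> {u..z}" using insert.prems by auto
    show "T \<subseteq> {u<..<z}" using insert.prems insert.hyps by auto
  qed (rule z)
  then obtain Q where Q: "interval_partition (card T + 1) ?L Q"
    "\<And>I. I \<in> Q \<Longrightarrow> \<exists>c d. u \<le> c \<and> c < d \<and> d \<le> z \<and> I \<subseteq> {c..d} \<and> {c<..<d} \<inter> T = {}"
    by blast
  have R: "is_interval ?R" using insert.prems(1) by (auto simp: is_interval_1)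
  have "{z<..<v} \<subseteq> ?R" using insert.prems z by force
  then have Rn: "nontrivial_interval ?R" using R z by (intro nontrivial_intervalI)
  have ne: "?R \<noteq> {}" using insert.prems z by force
  have QL: "\<Union>Q = ?L" using Q(1) by (auto simp: interval_partition_def partition_on_def)
  have "partition_on J (insert ?R Q)"
  proof (subst partition_on_insert)
    show "disjnt ?R (\<Union>Q)" unfolding QL by (auto simp: disjnt_def)
    have "J - ?R = ?L" by auto
    then show "partition_on (J - ?R) Q \<and> ?R \<subseteq> J \<and> ?R \<noteq> {}"
      using Q(1) ne by (auto simp: interval_partition_def)
  qed
  moreover have "card (insert ?R Q) \<le> card (insert z T) + 1"
  proof -
    have "card (insert z T) = card T + 1" using insert.hyps by auto
    moreover have "card (insert ?R Q) \<le> card Q + 1"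
      using Q(1) by (simp add: card_insert_if interval_partition_def)
    ultimately show ?thesis using Q(1) by (simp add: interval_partition_def)
  qed
  ultimately have "interval_partition (card (insert z T) + 1) J (insert ?R Q)"
    using Q(1) Rn by (auto simp: interval_partition_def)
  moreover have "\<exists>c d. u \<le> c \<and> c < d \<and> d \<le> v \<and> I \<subseteq> {c..d} \<and> {c<..<d} \<inter> insert z T = {}"
    if I: "I \<in> insert ?R Q" for I
  proof (cases "I = ?R")
    case True
    then have "I \<subseteq> {z..v}" using insert.prems(3) by auto
    moreover have "{z<..<v} \<inter> insert z T = {}" using insert.hyps by force
    ultimately show ?thesis using z by (intro exI[of _ z] exI[of _ v]) auto
  next
    case False
    then obtain c d where "u \<le> c" "c < d" "d \<le> z" "I \<subseteq> {c..d}" "{c<..<d} \<inter> T = {}"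
      using I Q(2) by blast
    then show ?thesis using z by (intro exI[of _ c] exI[of _ d]) auto
  qed
  ultimately show ?case by blast
qed

lemma interval_partition_refine:
  assumes P: "interval_partition K X P" and Q: "\<And>J. J \<in> P \<Longrightarrow> interval_partition (N J) J (Q J)"
  shows "interval_partition (\<Sum>J\<in>P. N J) X (\<Union>J\<in>P. Q J)"
proof -
  have U: "\<Union>(Q J) = J" if "J \<in> P" for J
    using Q[OF that] by (auto simp: interval_partition_def partition_on_def)
  have "partition_on X (\<Union>J\<in>P. Q J)"
  proof (rule partition_onI)
    have "\<Union>(\<Union>J\<in>P. Q J) = (\<Union>J\<in>P. \<Union>(Q J))" by auto
    also have "\<dots> = X" using U P by (auto simp: interval_partition_def partition_on_def)
    finally show "\<Union>(\<Union>J\<in>P. Q J) = X" .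
    show "{} \<notin> (\<Union>J\<in>P. Q J)" using Q by (auto simp: interval_partition_def partition_on_def)
    fix A B assume "A \<in> (\<Union>J\<in>P. Q J)" "B \<in> (\<Union>J\<in>P. Q J)" "A \<noteq> B"
    then obtain J J' where J: "J \<in> P" "A \<in> Q J" "J' \<in> P" "B \<in> Q J'" by auto
    show "disjnt A B"
    proof (cases "J = J'")
      case True
      then show ?thesis
        using J Q[of J] \<open>A \<noteq> B\<close> by (auto simp: interval_partition_def partition_on_def pairwise_def)
    next
      case False
      then have "disjnt J J'"
        using J P by (auto simp: interval_partition_def partition_on_def pairwise_def)
      moreover have "A \<subseteq> J" "B \<subseteq> J'" using J U by blast+
      ultimately show ?thesis by (meson disjnt_subset1 disjnt_subset2)
    qed
  qed
  moreover have "finite P" using P by (simp add: interval_partition_def)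
  moreover have "card (\<Union>J\<in>P. Q J) \<le> (\<Sum>J\<in>P. N J)"
  proof -
    have "card (\<Union>J\<in>P. Q J) \<le> (\<Sum>J\<in>P. card (Q J))" using \<open>finite P\<close> by (rule card_UN_le)
    also have "\<dots> \<le> (\<Sum>J\<in>P. N J)" using Q by (intro sum_mono) (auto simp: interval_partition_def)
    finally show ?thesis .
  qed
  ultimately show ?thesis using Q by (auto simp: interval_partition_def)
qed

lemma interval_partition_mono:
  "interval_partition K X P \<Longrightarrow> K \<le> K' \<Longrightarrow> interval_partition K' X P"
  by (auto simp: interval_partition_def)

text \<open>Since the points lie in \<open>{a..b}\<close>, the spacing \<open>(b - a) / n\<close> forces \<open>x 1\<close> and \<open>x n\<close> to be
  within one step of the ends, so that no gap exceeds the spacing.\<close>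

lemma length_le_num_points:
  fixes x :: "nat \<Rightarrow> real"
  assumes n: "1 \<le> n" and ab: "a < b" and \<delta>: "\<delta> = (b - a) / real n"
    and x: "\<And>i. i \<in> {1..n} \<Longrightarrow> x i \<in> {a..b}" "\<And>i. i \<in> {1..n} \<Longrightarrow> x i = x 1 + (real i - 1) * \<delta>"
    and uv: "a \<le> u" "v \<le> b" "{u<..<v} \<subseteq> J"
  shows "v - u \<le> (real (num_points n x J) + 1) * \<delta>"
proof (rule ccontr)
  define m where "m = num_points n x J"
  assume "\<not> v - u \<le> (real (num_points n x J) + 1) * \<delta>"
  then have big: "(real m + 1) * \<delta> < v - u" by (simp add: m_def)
  have \<delta>0: "0 < \<delta>" "real n * \<delta> = b - a" using n ab by (auto simp: \<delta>)
  \<comment> \<open>A fictitious grid point of index 0. The grid continued to index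
    \<open>n + 1\<close> then covers \<open>{a..b}\<close>.\<close>
  define c where "c = x 1 - \<delta>"
  have x1: "a \<le> x 1" "x 1 + (real n - 1) * \<delta> \<le> b" using x(1)[of 1] x(1)[of n] x(2)[of n] n by auto
  have c: "c \<le> a" "b \<le> c + (real n + 1) * \<delta>" using x1 \<delta>0 by (auto simp: c_def algebra_simps)
  have xc: "x i = c + real i * \<delta>" if "i \<in> {1..n}" for i
    using x(2)[OF that] by (simp add: c_def algebra_simps)
  \<comment> \<open>\<open>i0\<close> is the last grid index at or before \<open>u\<close>. If the
    interval were too long, the next \<open>m + 1\<close> grid points would all lie strictly between
    \<open>u\<close> and \<open>v\<close>, one more than the count \<open>m\<close>.\<close>
  define i0 where "i0 = nat \<lfloor>(u - c) / \<delta>\<rfloor>"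
  have "0 \<le> (u - c) / \<delta>" using c uv \<delta>0 by simp
  then have "real i0 \<le> (u - c) / \<delta>" "(u - c) / \<delta> < real i0 + 1" unfolding i0_def by linarith+
  then have i0: "real i0 * \<delta> \<le> u - c" "u - c < (real i0 + 1) * \<delta>"
    using \<delta>0 by (auto simp: field_simps)
  have "i0 + 1 + j \<in> {i \<in> {1..n}. x i \<in> J}" if "j \<le> m" for j
  proof -
    let ?i = "i0 + 1 + j"
    have "real j * \<delta> \<le> real m * \<delta>" "0 \<le> real j * \<delta>"
      using that \<delta>0 by (auto intro!: mult_right_mono)
    moreover have "real ?i * \<delta> = real i0 * \<delta> + \<delta> + real j * \<delta>" by (simp add: algebra_simps)
    moreover have "u - c < real i0 * \<delta> + \<delta>" "real m * \<delta> + \<delta> < v - u"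
      using i0 big by (simp_all only: distrib_right mult_1)
    ultimately have i: "u < c + real ?i * \<delta>" "c + real ?i * \<delta> < v"
      using i0(1) by linarith+
    then have "real ?i * \<delta> < (real n + 1) * \<delta>" using c uv by linarith
    then have "?i \<le> n" using \<delta>0 by simp
    then show ?thesis using i xc[of ?i] uv by auto
  qed
  then have "(\<lambda>j. i0 + 1 + j) ` {..m} \<subseteq> {i \<in> {1..n}. x i \<in> J}" by auto
  then have "card ((\<lambda>j. i0 + 1 + j) ` {..m}) \<le> m"
    unfolding m_def num_points_def by (intro card_mono) auto
  moreover have "card ((\<lambda>j. i0 + 1 + j) ` {..m}) = m + 1"
    by (subst card_image) (auto simp: inj_on_def)
  ultimately show False by simp
qed

section \<open>Gluing the pieces\<close>

text \<open>Write \<open>?S\<close> for \<open>sum s P\<close>. The lower bound on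
  \<open>d J\<close> gives \<open>s J ^ 3 / (d J)\<^sup>2 \<le> s J * ?S\<^sup>2 /
  \<gamma>\<^sup>2\<close>, and summing the factor \<open>s J\<close> supplies the third
  power.\<close>

lemma sum_cubes_div_square_le:
  fixes s :: "'a \<Rightarrow> real"
  assumes "finite P" "\<And>J. J \<in> P \<Longrightarrow> 0 \<le> s J" "0 < \<gamma>" "\<And>J. J \<in> P \<Longrightarrow> 0 < d J"
    "\<And>J. J \<in> P \<Longrightarrow> \<gamma> * s J / sum s P \<le> d J"
  shows "(\<Sum>J\<in>P. s J ^ 3 / (d J)\<^sup>2) \<le> sum s P ^ 3 / \<gamma>\<^sup>2"
proof -
  let ?S = "sum s P"
  have "s J ^ 3 / (d J)\<^sup>2 \<le> s J * (?S\<^sup>2 / \<gamma>\<^sup>2)" if J: "J \<in> P" for J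
  \<comment> \<open>Only a positive \<open>s J\<close> guarantees a positive total by which to
    divide; for \<open>s J = 0\<close> both sides vanish.\<close>
  proof (cases "s J = 0")
    case False
    then have sJ: "0 < s J" using assms(2)[OF J] by simp
    also have "s J \<le> ?S" using assms J by (intro member_le_sum) auto
    finally have S: "0 < ?S" .
    have "\<gamma> * s J \<le> d J * ?S" using assms(5)[OF J] S by (simp add: pos_divide_le_eq)
    then have "(\<gamma> * s J)\<^sup>2 \<le> (d J * ?S)\<^sup>2" using assms(3) sJ by (intro power_mono) auto
    then have "s J * (\<gamma> * s J)\<^sup>2 \<le> s J * (d J * ?S)\<^sup>2" using sJ by (intro mult_left_mono) auto
    then show ?thesis
      using assms(3) assms(4)[OF J] by (simp add: field_simps power2_eq_square power3_eq_cube)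
  qed simp
  then have "(\<Sum>J\<in>P. s J ^ 3 / (d J)\<^sup>2) \<le> (\<Sum>J\<in>P. s J * (?S\<^sup>2 / \<gamma>\<^sup>2))" by (rule sum_mono)
  also have "\<dots> = ?S ^ 3 / \<gamma>\<^sup>2"
    unfolding sum_distrib_right[symmetric] by (simp add: power2_eq_square power3_eq_cube)
  finally show ?thesis .
qed

lemma convex_on_eq:
  assumes f: "convex_on S f" and eq: "\<And>x. x \<in> S \<Longrightarrow> f x = g x"
  shows "convex_on S g"
proof (rule convex_onI)
  fix t :: real and x y assume t: "0 < t" "t < 1" and xy: "x \<in> S" "y \<in> S"
  have "(1 - t) *\<^sub>R x + t *\<^sub>R y \<in> S"
    using convex_on_imp_convex[OF f] t xy by (intro convexD) auto
  then show "g ((1 - t) *\<^sub>R x + t *\<^sub>R y) \<le> (1 - t) * g x + t * g y"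
    using convex_onD[OF f _ _ xy, of t] t xy eq by simp
qed (rule convex_on_imp_convex[OF f])

text \<open>The open set \<open>{u<..<v}\<close> lies in \<open>J\<close>, hence misses
  \<open>J'\<close> and therefore also its closure.\<close>

lemma endpoint_of_closure_point:
  fixes u v :: real
  assumes P: "partition_on X P" and J: "J \<in> P" "J' \<in> P" "J \<noteq> J'"
    and sub: "{u<..<v} \<subseteq> J" "J \<subseteq> {u..v}" and x: "x \<in> J" "x \<in> closure J'"
  shows "x = u \<or> x = v"
proof (rule ccontr)
  assume "\<not> (x = u \<or> x = v)"
  moreover have "x \<in> {u..v}" using x sub by blast
  ultimately have "x \<in> {u<..<v}" 
    unfolding atLeastAtMost_iff greaterThanLessThan_iff order_less_le by blast
  then have "{u<..<v} \<inter> J' \<noteq> {}" using x(2) open_Int_closure_eq_empty[of "{u<..<v}" J'] by auto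
  then have "\<not> disjnt J J'" using sub(1) by (auto simp: disjnt_def)
  then show False using J P by (auto simp: partition_on_def pairwise_def)
qed

theorem proposition6:
  fixes a b L \<gamma> V W :: real and X :: "real set" and n k :: nat
    and x :: "nat \<Rightarrow> real" and f :: "real \<Rightarrow> real" and P :: "real set set"
  assumes "X = {a..b}" and "L = b - a" and "L > 0"
    and "n \<ge> 1"
    and "\<forall>i\<in>{1..n}. x i \<in> X"
    and "\<forall>i\<in>{1..<n}. x (i + 1) - x i = L / real n"
    and "k \<ge> 1"
    and "f \<in> class_C k X"
    and "associated_partition k X f P"
    and "V = variation P f"
    and "W = variation_index n x P f"
    and "\<gamma> > 0"
  shows "\<exists>g \<in> O_pl k X (nat \<lfloor>2 * (real k + \<gamma>)\<rfloor>).
           (1 / real n) * (\<Sum>i=1..n. \<bar>f (x i) - g (x i)\<bar>) \<le> W / \<gamma>\<^sup>2 + 2 * V / real n"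
proof -

  \<comment> \<open>Design points and elements of the partition\<close>
  define \<delta> where "\<delta> = (b - a) / real n"
  have \<delta>: "0 < \<delta>" using assms by (simp add: \<delta>_def)
  have part: "partition_on X P" "finite P" "card P \<le> k" "\<And>J. J \<in> P \<Longrightarrow> nontrivial_interval J"
    and shape: "\<And>J. J \<in> P \<Longrightarrow> monotone_or_antitone_on (closure J) f"
      "\<And>J. J \<in> P \<Longrightarrow> convex_concave_on (closure J) f"
    using assms(9) unfolding associated_partition_def interval_partition_def by auto
  have cont: "continuous_on X f" using assms(8) by (simp add: class_C_def)
  have sub: "J \<subseteq> {a..b}" if "J \<in> P" for J
    using that part(1) assms(1) by (auto simp: partition_on_def)
  note ends = nontrivial_interval_endpoints[OF part(4) sub]
  have clX: "closure J \<subseteq> X" if "J \<in> P" for J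
    using sub[OF that] assms(1) by (simp add: closure_minimal)
  have uv: "a \<le> Inf J" "Sup J \<le> b" if "J \<in> P" for J
    using clX[OF that] ends(1)[OF that that] unfolding ends(4)[OF that that] assms(1) by auto
  have xi: "x i = x 1 + (real i - 1) * \<delta>" if "i \<in> {1..n}" for i
  proof -
    have "1 \<le> i \<Longrightarrow> i \<le> n \<Longrightarrow> x i = x 1 + (real i - 1) * \<delta>"
    proof (induction i rule: dec_induct)
      case (step j)
      then have "j \<in> {1..<n}" by auto
      with assms(6) have "x (j + 1) - x j = L / real n" by blast
      then have "x (Suc j) = x j + \<delta>" by (simp add: \<delta>_def assms(2))
      then show ?case using step by (simp add: algebra_simps)
    qed simp
    then show ?thesis using that by auto
  qed
  have xdiff: "x i - x j = (real i - real j) * \<delta>" if "i \<in> {1..n}" "j \<in> {1..n}" for i j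
    unfolding xi[OF that(1)] xi[OF that(2)] by (simp add: algebra_simps)
  have inj: "inj_on x {1..n}"
  proof (rule inj_onI)
    fix i j assume "i \<in> {1..n}" "j \<in> {1..n}" "x i = x j"
    then show "i = j" using xdiff[of i j] \<delta> by simp
  qed

  \<comment> \<open>Distribution of the breakpoints over the elements\<close>
  define S where "S J = x ` {i \<in> {1..n}. x i \<in> J}" for J
  have cardS: "card (S J) = num_points n x J" for J
    unfolding S_def num_points_def by (intro card_image inj_on_subset[OF inj]) auto
  have sepS: "separated \<delta> (S J)" for J
    unfolding separated_def
  proof (intro ballI impI)
    fix y z assume "y \<in> S J" "z \<in> S J" "y \<noteq> z"
    then obtain i j where ij: "i \<in> {1..n}" "j \<in> {1..n}" "y = x i" "z = x j" "i \<noteq> j"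
      by (auto simp: S_def)
    have "1 * \<delta> \<le> \<bar>real i - real j\<bar> * \<delta>" using ij(5) \<delta> by (intro mult_right_mono) auto
    then show "\<delta> \<le> \<bar>y - z\<bar>" using xdiff[OF ij(1,2)] ij \<delta> by (simp add: abs_mult)
  qed
  define \<Gamma> where "\<Gamma> J = linear_index f (Inf J) (Sup J)" for J
  define N where "N J = real (num_points n x J)" for J
  define s where "s J = root 3 (N J * variation_on f J * \<Gamma> J / real n)" for J
  \<comment> \<open>The added 1 makes \<open>D J\<close> positive and at least
    \<open>\<gamma> * s J / sum s P\<close>, while exceeding that quotient by at most 1. If
    \<open>sum s P = 0\<close>, the quotient is 0 and \<open>D J = 1\<close>.\<close>
  define D where "D J = nat \<lfloor>\<gamma> * s J / sum s P\<rfloor> + 1" for J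
  have var: "variation_on f J = \<bar>f (Sup J) - f (Inf J)\<bar>" if "J \<in> P" for J
    using variation_on_eq[OF part(4)[OF that] sub[OF that]] shape(1)[OF that]
      continuous_on_subset[OF cont clX[OF that]] by blast
  have piece: "0 \<le> variation_on f J * \<Gamma> J \<and> spline_approx f (Inf J) (Sup J) (2 * D J) (S J)
      (N J * variation_on f J * \<Gamma> J / (real (D J))\<^sup>2 + 2 * variation_on f J)" if J: "J \<in> P" for J
    unfolding var[OF J] N_def cardS[symmetric] \<Gamma>_def
  proof (rule spline_approx_monotone)
    show "Inf J < Sup J" using ends(1) J by auto
    show "continuous_on {Inf J..Sup J} f"
      using continuous_on_subset[OF cont clX[OF J]] unfolding ends(4)[OF J J] .
    show "convex_concave_on {Inf J..Sup J} f" "monotone_or_antitone_on {Inf J..Sup J} f"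
      using shape[OF J] unfolding ends(4)[OF J J] by auto
    show "S J \<subseteq> {Inf J..Sup J}" using ends(3)[OF J J] by (auto simp: S_def)
    show "Sup J - Inf J \<le> (real (card (S J)) + 1) * \<delta>"
      unfolding cardS
      by (rule length_le_num_points[OF assms(4) _ \<delta>_def _ xi uv[OF J] ends(2)[OF J J]])
        (use assms in auto)
  qed (use \<delta> sepS in \<open>auto simp: D_def S_def\<close>)
  have s_cube: "s J ^ 3 = N J * variation_on f J * \<Gamma> J / real n" for J
    unfolding s_def by (simp add: odd_real_root_pow)
  have s0: "0 \<le> s J" if "J \<in> P" for J
    unfolding s_def using piece[OF that] by (auto simp: N_def mult.assoc)
  have S0: "0 \<le> sum s P" using s0 by (rule sum_nonneg)
  have D_ge: "\<gamma> * s J / sum s P \<le> real (D J)" for J unfolding D_def by linarith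
  have D_le: "real (D J) \<le> \<gamma> * s J / sum s P + 1" if "J \<in> P" for J
  proof -
    have "0 \<le> \<gamma> * s J / sum s P" using s0[OF that] S0 assms(12) by simp
    then show ?thesis unfolding D_def by simp
  qed
  obtain g T where gT: "\<And>J. J \<in> P \<Longrightarrow> spline_approx_by f (Inf J) (Sup J) (2 * D J) (S J)
      (N J * variation_on f J * \<Gamma> J / (real (D J))\<^sup>2 + 2 * variation_on f J) (g J) (T J)"
    using piece unfolding spline_approx_def by metis
  have g_end: "\<And>J. J \<in> P \<Longrightarrow> g J (Inf J) = f (Inf J)" "\<And>J. J \<in> P \<Longrightarrow> g J (Sup J) = f (Sup J)"
    and g_cont: "\<And>J. J \<in> P \<Longrightarrow> continuous_on {Inf J..Sup J} (g J)"
    and g_shape: "\<And>J. J \<in> P \<Longrightarrow> monotone_or_antitone_on {Inf J..Sup J} (g J)"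
      "\<And>J. J \<in> P \<Longrightarrow> convex_concave_on {Inf J..Sup J} (g J)"
    and T: "\<And>J. J \<in> P \<Longrightarrow> finite (T J)" "\<And>J. J \<in> P \<Longrightarrow> T J \<subseteq> {Inf J<..<Sup J}"
      "\<And>J. J \<in> P \<Longrightarrow> card (T J) < 2 * D J"
    and g_affine: "\<And>J c d. J \<in> P \<Longrightarrow> Inf J \<le> c \<Longrightarrow> c < d \<Longrightarrow> d \<le> Sup J \<Longrightarrow> {c<..<d} \<inter> T J = {} \<Longrightarrow>
      affine_fun_on {c..d} (g J)"
    and g_err: "\<And>J. J \<in> P \<Longrightarrow> (\<Sum>x\<in>S J. \<bar>f x - g J x\<bar>) \<le>
        N J * variation_on f J * \<Gamma> J / (real (D J))\<^sup>2 + 2 * variation_on f J"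
    using gT unfolding spline_approx_by_def by blast+

  \<comment> \<open>The glued function and its shape\<close>
  define h where "h y = g (THE J. J \<in> P \<and> y \<in> J) y" for y
  have hJ: "h y = g J y" if "J \<in> P" "y \<in> J" for J y
  proof -
    have "(THE J. J \<in> P \<and> y \<in> J) = J"
      using that part(1) by (intro the_equality) (auto simp: partition_on_def pairwise_def disjnt_def)
    then show ?thesis by (simp add: h_def)
  qed
  have XP: "X = \<Union>P" using part(1) by (rule partition_onD1)
  \<comment> \<open>An end point of \<open>J\<close> may belong to another element
    \<open>J'\<close>. It is then an end point of \<open>J'\<close> as well, where that interpolant
    also takes the value of \<open>f\<close>.\<close>
  have h_end: "h y = f y" if J: "J \<in> P" "y = Inf J \<or> y = Sup J" for J y
  proof -
    have y: "y \<in> closure J" using J ends(1)[OF J(1) J(1)] unfolding ends(4)[OF J(1) J(1)] by auto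
    then obtain J' where J': "J' \<in> P" "y \<in> J'" using clX[OF J(1)] XP by auto
    show ?thesis
    proof (cases "J' = J")
      case True
      then show ?thesis using hJ[OF J'] J g_end[OF J(1)] by auto
    next
      case False
      then have "y = Inf J' \<or> y = Sup J'"
        using endpoint_of_closure_point[OF part(1) J'(1) J(1) _ _ _ J'(2) y] ends(2,3)[OF J'(1) J'(1)] by auto
      then show ?thesis using hJ[OF J'] g_end[OF J'(1)] by auto
    qed
  qed
  \<comment> \<open>Agreement at the end points extends \<open>hJ\<close> to the closure of
    \<open>J\<close>. Continuity then follows from the finite closed cover, and the shape on each
    closure is inherited from \<open>g J\<close>.\<close>
  have h_cl: "h y = g J y" if J: "J \<in> P" "y \<in> {Inf J..Sup J}" for J y
  proof (cases "y \<in> J")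
    case False
    then have "y = Inf J \<or> y = Sup J" using J ends(2)[OF J(1) J(1)] by force
    then show ?thesis using h_end[OF J(1)] g_end[OF J(1)] by auto
  qed (use hJ J in auto)
  have "continuous_on {Inf J..Sup J} h" if "J \<in> P" for J
    by (rule continuous_on_eq[OF g_cont[OF that]]) (simp add: h_cl[OF that])
  then have "continuous_on (\<Union>J\<in>P. {Inf J..Sup J}) h"
    using part(2) by (intro continuous_on_closed_Union) auto
  moreover have "(\<Union>J\<in>P. {Inf J..Sup J}) = X"
  proof
    show "(\<Union>J\<in>P. {Inf J..Sup J}) \<subseteq> X" using clX ends(4) by fastforce
    show "X \<subseteq> (\<Union>J\<in>P. {Inf J..Sup J})" unfolding XP using ends(3) by fastforce
  qed
  ultimately have h_cont: "continuous_on X h" by simp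
  have "associated_partition k X h P"
    unfolding associated_partition_def
  proof (intro conjI ballI)
    show "interval_partition k X P" using part by (simp add: interval_partition_def)
    fix J assume J: "J \<in> P"
    have eq: "\<forall>y\<in>{Inf J..Sup J}. h y = g J y" using h_cl[OF J] by blast
    show "monotone_or_antitone_on (closure J) h"
      using g_shape(1)[OF J] eq unfolding ends(4)[OF J J] monotone_or_antitone_on_def monotone_on_def
      by auto
    have "convex_on {Inf J..Sup J} (g J) \<Longrightarrow> convex_on {Inf J..Sup J} h"
      "convex_on {Inf J..Sup J} (\<lambda>y. - g J y) \<Longrightarrow> convex_on {Inf J..Sup J} (\<lambda>y. - h y)"
      using eq by (auto elim!: convex_on_eq)
    then show "convex_concave_on (closure J) h"
      using g_shape(2)[OF J] unfolding ends(4)[OF J J] convex_concave_on_def concave_on_def by blast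
  qed
  then have "h \<in> class_C k X" using h_cont by (auto simp: class_C_def)

  \<comment> \<open>Counting the affine pieces\<close>
  moreover have "piecewise_linear_on (nat \<lfloor>2 * (real k + \<gamma>)\<rfloor>) X h"
  proof -
    have "\<exists>Q. interval_partition (2 * D J) J Q \<and> (\<forall>I\<in>Q. affine_fun_on I h)" if J: "J \<in> P" for J
    proof -
      have "is_interval J" using part(4)[OF J] by (simp add: nontrivial_interval_def)
      then obtain Q where Q: "interval_partition (card (T J) + 1) J Q"
        "\<And>I. I \<in> Q \<Longrightarrow> \<exists>c d. Inf J \<le> c \<and> c < d \<and> d \<le> Sup J \<and> I \<subseteq> {c..d} \<and> {c<..<d} \<inter> T J = {}"
        using nontrivial_interval_split[OF _ ends(2,3,1)[OF J J] T(1,2)[OF J]] by blast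
      have "affine_fun_on I h" if I: "I \<in> Q" for I
      proof -
        obtain c d where cd: "Inf J \<le> c" "c < d" "d \<le> Sup J" "I \<subseteq> {c..d}" "{c<..<d} \<inter> T J = {}"
          using Q(2)[OF I] by blast
        obtain p q where "\<forall>y\<in>{c..d}. g J y = p * y + q"
          using g_affine[OF J cd(1,2,3,5)] unfolding affine_fun_on_def by blast
        moreover have "h y = g J y" if "y \<in> I" for y using h_cl[OF J, of y] cd that by auto
        ultimately have "\<forall>y\<in>I. h y = p * y + q" using cd(4) by auto
        then show ?thesis unfolding affine_fun_on_def by blast
      qed
      moreover have "interval_partition (2 * D J) J Q"
        using interval_partition_mono[OF Q(1)] T(3)[OF J] by simp
      ultimately show ?thesis by blast
    qed
    then obtain Q where Q: "\<And>J. J \<in> P \<Longrightarrow> interval_partition (2 * D J) J (Q J)"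
      "\<And>J I. J \<in> P \<Longrightarrow> I \<in> Q J \<Longrightarrow> affine_fun_on I h" by metis
    have "interval_partition k X P" using part by (simp add: interval_partition_def)
    then have refined: "interval_partition (\<Sum>J\<in>P. 2 * D J) X (\<Union>J\<in>P. Q J)"
      using Q(1) by (rule interval_partition_refine)
    \<comment> \<open>The quotients \<open>s J / sum s P\<close> add up to 1, or to 0 if the total
      vanishes, and the roundings add at most \<open>card P \<le> k\<close>. Integrality of the
      left-hand side then permits the floor.\<close>
    have "(\<Sum>J\<in>P. real (D J)) \<le> (\<Sum>J\<in>P. \<gamma> * s J / sum s P + 1)" using D_le by (rule sum_mono)
    also have "\<dots> = \<gamma> * (sum s P / sum s P) + real (card P)"
      by (simp add: sum.distrib flip: sum_distrib_left sum_divide_distrib)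
    also have "\<dots> \<le> \<gamma> + real k" using assms(12) part(3) by (cases "sum s P = 0") auto
    finally have "real (\<Sum>J\<in>P. 2 * D J) \<le> 2 * (real k + \<gamma>)" by (simp add: sum_distrib_left[symmetric])
    then have "(\<Sum>J\<in>P. 2 * D J) \<le> nat \<lfloor>2 * (real k + \<gamma>)\<rfloor>" by (rule le_nat_floor)
    from interval_partition_mono[OF refined this] show ?thesis
      unfolding piecewise_linear_on_def using h_cont Q(2) by blast
  qed
  ultimately have "h \<in> O_pl k X (nat \<lfloor>2 * (real k + \<gamma>)\<rfloor>)" by (simp add: O_pl_def)

  \<comment> \<open>The average error\<close>
  moreover have "(1 / real n) * (\<Sum>i=1..n. \<bar>f (x i) - h (x i)\<bar>) \<le> W / \<gamma>\<^sup>2 + 2 * V / real n"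
  proof -
    have "(\<Sum>i=1..n. \<bar>f (x i) - h (x i)\<bar>) = (\<Sum>y\<in>x ` {1..n}. \<bar>f y - h y\<bar>)"
      using inj by (simp add: sum.reindex)
    also have "x ` {1..n} = (\<Union>J\<in>P. S J)" using assms(5) XP unfolding S_def by blast
    also have "(\<Sum>y\<in>(\<Union>J\<in>P. S J). \<bar>f y - h y\<bar>) \<le> (\<Sum>J\<in>P. \<Sum>y\<in>S J. \<bar>f y - h y\<bar>)"
      using part(2) by (intro sum_UN_le) (auto simp: S_def)
    also have "\<dots> = (\<Sum>J\<in>P. \<Sum>y\<in>S J. \<bar>f y - g J y\<bar>)"
      using hJ by (intro sum.cong) (auto simp: S_def)
    also have "\<dots> \<le> (\<Sum>J\<in>P. N J * variation_on f J * \<Gamma> J / (real (D J))\<^sup>2 + 2 * variation_on f J)"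
      using g_err by (rule sum_mono)
    finally have "(1 / real n) * (\<Sum>i=1..n. \<bar>f (x i) - h (x i)\<bar>) \<le>
        (1 / real n) * (\<Sum>J\<in>P. N J * variation_on f J * \<Gamma> J / (real (D J))\<^sup>2 + 2 * variation_on f J)"
      by (rule mult_left_mono) simp
    \<comment> \<open>The factor \<open>1 / n\<close> turns each leading term into
      \<open>s J ^ 3 / (real (D J))\<^sup>2\<close>, the form to which the choice of
      \<open>D J\<close> is adapted.\<close>
    also have "\<dots> = (\<Sum>J\<in>P. s J ^ 3 / (real (D J))\<^sup>2) + 2 * V / real n"
      unfolding assms(10) variation_def s_cube
      by (simp add: sum.distrib sum_distrib_left sum_divide_distrib add_divide_distrib mult.commute)
    also have "\<dots> \<le> sum s P ^ 3 / \<gamma>\<^sup>2 + 2 * V / real n"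
      using part(2) s0 assms(12) D_ge
      by (intro add_right_mono sum_cubes_div_square_le) (auto simp: D_def)
    also have "sum s P ^ 3 = W"
      unfolding assms(11) variation_index_def s_def N_def \<Gamma>_def ..
    finally show ?thesis .
  qed
  ultimately show ?thesis by blast
qed

end
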